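(* Let $X$ be an $L$-embedded Banach space and let $(S,(X,\mathrm{weak}))$ be a nonexpansive and norm-distal dynamical system. If there is a nonempty bounded set $A\subset X$ such that $s(A)=A$ for all $s\in S$, then there is a fixed point of $S$ located in the Chebyshev center of $A$; that is, there is $x\in X$ with $sx=x$ for all $s\in S$ and $$\sup_{y\in A}\|x-y\|=\inf_{z\in X}\sup_{y\in A}\|z-y\|.$$
   Context: A dynamical system $(S,(X,\mathrm{weak}))$ consists of a semigroup $S$ and a semigroup action $S\times X\to X$, $(s,x)\mapsto sx$ (so $(st)x=s(tx)$), such that for each $s\in S$ the (not necessarily linear or affine) map $x\mapsto sx$ is continuous from $X$ with the weak topology to itself. It is nonexpansive if $\|sx-sy\|\le\|x-y\|$ for all $s\in S$, $x,y\in X$, and norm-distal if for every pair of distinct $x,y\in X$, $0$ does not belong to the norm closure of $\{sx-sy:s\in S\}$. We write $s(A)=\{sa:a\in A\}$. A Banach space $X$ is $L$-embedded if its bidual can be decomposed as $X^{**}=X\oplus_1X_s$ for some subspace $X_s\subset X^{**}$, i.e. $X^{**}$ is the direct sum of (the canonical image of) $X$ and $X_s$, and $\|x+\xi\|=\|x\|+\|\xi\|$ for $x\in X$, $\xi\in X_s$. *)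

theory Defs
  imports "HOL-Analysis.Analysis"
begin

text \<open>The dual of \<open>'a\<close> is the type \<open>'a \<Rightarrow>\<^sub>L real\<close> of bounded linear functionals with the operator norm.\<close>

definition weak_topology :: "'a::real_normed_vector topology" where
  "weak_topology =
     topology_generated_by {blinfun_apply f -` U | (f :: 'a \<Rightarrow>\<^sub>L real) U. open U}"

lift_definition bidual_embedding :: "'a::real_normed_vector \<Rightarrow> ('a \<Rightarrow>\<^sub>L real) \<Rightarrow>\<^sub>L real"
  is "\<lambda>x f. blinfun_apply f x"
  by (rule blinfun.bounded_linear_left)

definition L_embedded :: "'a::real_normed_vector itself \<Rightarrow> bool" where
  "L_embedded _ \<longleftrightarrow>
     (\<exists>Xs :: (('a \<Rightarrow>\<^sub>L real) \<Rightarrow>\<^sub>L real) set.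
        subspace Xs \<and>
        range (bidual_embedding :: 'a \<Rightarrow> _) \<inter> Xs = {0} \<and>
        {bidual_embedding x + \<xi> | (x :: 'a) \<xi>. \<xi> \<in> Xs} = UNIV \<and>
        (\<forall>(x :: 'a) \<xi>. \<xi> \<in> Xs \<longrightarrow> norm (bidual_embedding x + \<xi>) = norm x + norm \<xi>))"

definition weak_dynamical_system ::
    "('s::semigroup_mult \<Rightarrow> 'a::real_normed_vector \<Rightarrow> 'a) \<Rightarrow> bool" where
  "weak_dynamical_system act \<longleftrightarrow>
     (\<forall>s t x. act (s * t) x = act s (act t x)) \<and>
     (\<forall>s. continuous_map weak_topology weak_topology (act s))"

definition nonexpansive :: "('s \<Rightarrow> 'a::real_normed_vector \<Rightarrow> 'a) \<Rightarrow> bool" where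
  "nonexpansive act \<longleftrightarrow> (\<forall>s x y. norm (act s x - act s y) \<le> norm (x - y))"

definition norm_distal :: "('s \<Rightarrow> 'a::real_normed_vector \<Rightarrow> 'a) \<Rightarrow> bool" where
  "norm_distal act \<longleftrightarrow>
     (\<forall>x y. x \<noteq> y \<longrightarrow> 0 \<notin> closure (range (\<lambda>s. act s x - act s y)))"

text \<open>Only meaningful for nonempty bounded \<open>A\<close>, since suprema of reals are otherwise unspecified.\<close>

definition chebyshev_center :: "'a::real_normed_vector set \<Rightarrow> 'a set" where
  "chebyshev_center A =
     {x. (SUP y\<in>A. norm (x - y)) = (INF z. SUP y\<in>A. norm (z - y))}"

lemma topspace_weak_topology [simp]: "topspace weak_topology = UNIV"
proof -
  have "UNIV \<in> {blinfun_apply f -` U | (f :: 'a \<Rightarrow>\<^sub>L real) U. open U}"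
    by (rule CollectI, intro exI[of _ "0 :: 'a \<Rightarrow>\<^sub>L real"] exI[of _ "UNIV :: real set"]) simp
  then show ?thesis
    by (auto simp: weak_topology_def topology_generated_by_topspace)
qed

end

theory Submission
  imports Defs
begin

text \<open>
Why the theorem is true. The Chebyshev center \<open>C\<close> of \<open>A\<close> is an intersection of balls, hence convex,
and it is mapped into itself by every \<open>s\<close> because \<open>s\<close> is nonexpansive and \<open>s(A) = A\<close>. In an
\<open>L\<close>-embedded space \<open>C\<close> is moreover nonempty and weakly compact
(\<open>chebyshev_center_weakly_compact\<close>): the corresponding center in the bidual is weak* compact, and
the \<open>X\<^sub>s\<close>-component of a point of it would strictly decrease the radius, so the center in the bidual
already lies in \<open>X\<close>. Since each \<open>s\<close> is weakly continuous, the fixed points of \<open>s\<close> in \<open>C\<close> form a weakly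
compact set, and by the finite intersection property it suffices to find a common fixed point of
finitely many maps at a time. This reduction makes the acting semigroup countable, which is what
brings in norm separability and lets Baire category replace the general fact that weakly compact
sets are fragmented by the norm.

For a countable semigroup \<open>G\<close> (\<open>countable_semigroup_fixed_point\<close>) take a minimal nonempty weakly
compact convex invariant set \<open>K \<subseteq> C\<close> and, inside it, a minimal nonempty weakly compact invariant set
\<open>M\<close>. Orbits in \<open>M\<close> are weakly dense, so \<open>M\<close> is norm separable, and Baire's theorem provides
nonempty relatively weakly open subsets of \<open>M\<close> of arbitrarily small norm diameter. They turn norm
distality into weak distality: if a limit \<open>p\<close> of maps in \<open>G\<close> identifies \<open>x\<close> and \<open>y\<close>, then pushing
the common value into a small open set by some \<open>t \<in> G\<close> brings \<open>t (g x)\<close> and \<open>t (g y)\<close> close in norm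
for some \<open>g \<in> G\<close>. Hence every element of the enveloping (Ellis) semigroup of \<open>M\<close> is injective, so
its idempotents are identities and it is a group (\<open>enveloping_semigroup_inverse\<close>). Its elements are
nonexpansive, because the norm is weakly lower semicontinuous; therefore each \<open>g \<in> G\<close> maps \<open>M\<close>
isometrically onto \<open>M\<close>. Preimages of one small open set cover \<open>M\<close>, finitely many of them suffice,
and being isometric preimages they are just as small: \<open>M\<close> is norm totally bounded.

If \<open>M\<close> had positive diameter \<open>d\<close>, averaging a finite \<open>d/2\<close>-net of \<open>M\<close> would yield a point of \<open>K\<close>
within some \<open>r < d\<close> of all of \<open>M\<close> (\<open>nondiametral_point\<close>). The points of \<open>K\<close> with this property form
a convex, weakly closed set, invariant because \<open>g(M) = M\<close>; by minimality it is all of \<open>K\<close>, in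
particular it contains \<open>M\<close>, and \<open>M\<close> would have diameter at most \<open>r\<close>. So \<open>M\<close> is a single
point, which \<open>G\<close> fixes.
\<close>

section \<open>Extension of linear functionals\<close>

definition sublinear :: "('a::real_vector \<Rightarrow> real) \<Rightarrow> bool" where
  "sublinear p \<longleftrightarrow> (\<forall>x y. p (x + y) \<le> p x + p y) \<and> (\<forall>c\<ge>0. \<forall>x. p (c *\<^sub>R x) = c * p x)"

lemma sublinearI:
  assumes "\<And>x y. p (x + y) \<le> p x + p y" and "\<And>c x. c > 0 \<Longrightarrow> p (c *\<^sub>R x) \<le> c * p x" and "p 0 = 0"
  shows "sublinear p"
proof -
  have "p (c *\<^sub>R x) = c * p x" if c: "c \<ge> 0" for c x
  proof (cases "c = 0")
    case False
    with c have "c > 0" by simp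
    moreover from this have "p x \<le> (1 / c) * p (c *\<^sub>R x)"
      using assms(2)[of "1 / c" "c *\<^sub>R x"] by simp
    ultimately have "c * p x \<le> p (c *\<^sub>R x)"
      by (simp add: field_simps)
    with assms(2)[OF \<open>c > 0\<close>, of x] show ?thesis by simp
  qed (use assms(3) in simp)
  with assms(1) show ?thesis by (simp add: sublinear_def)
qed

lemma sublinear_lower_bound:
  assumes "sublinear p" shows "- p (- x) \<le> p x"
proof -
  have "p 0 = 0" using assms unfolding sublinear_def by (metis mult_zero_left order_refl scaleR_zero_left)
  moreover have "p (x + - x) \<le> p x + p (- x)" using assms unfolding sublinear_def by blast
  ultimately show ?thesis by simp
qed

text \<open>
For each \<open>a\<close>, the infimum of \<open>p (x + t a) - t p a\<close> over \<open>t \<ge> 0\<close> is sublinear and lies below \<open>p\<close>. It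
serves twice: a minimal sublinear function must coincide with its own descent and is therefore
odd, and descending once in direction \<open>a\<close> before minimizing forces the value \<open>p a\<close> at \<open>a\<close>.
\<close>

lemma sublinear_descent:
  assumes p: "sublinear p"
  obtains q where "sublinear q" "\<And>x. q x \<le> p x" "q (- a) \<le> - p a"
proof -
  have add: "p (x + y) \<le> p x + p y" and hom: "c \<ge> 0 \<Longrightarrow> p (c *\<^sub>R x) = c * p x" for x y c
    using p by (auto simp: sublinear_def)
  define h where "h x t = p (x + t *\<^sub>R a) - t * p a" for x t
  define q where "q x = (INF t\<in>{0..}. h x t)" for x
  have lb: "- p (- x) \<le> h x t" if "t \<ge> 0" for x t
    using add[of "x + t *\<^sub>R a" "- x"] hom[OF that, of a] by (simp add: h_def)
  have q_le: "q x \<le> h x t" if "t \<ge> 0" for x t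
    unfolding q_def by (rule cINF_lower) (use that lb[of _ x] in \<open>auto intro!: bdd_belowI2\<close>)
  have q_ge: "m \<le> q x" if "\<And>t. t \<ge> 0 \<Longrightarrow> m \<le> h x t" for m x
    unfolding q_def by (rule cINF_greatest) (use that in auto)
  have "sublinear q"
  proof (rule sublinearI)
    fix x y
    have "q (x + y) \<le> h x s + h y t" if "s \<ge> 0" "t \<ge> 0" for s t
    proof -
      have "q (x + y) \<le> h (x + y) (s + t)" using q_le that by simp
      also have "\<dots> \<le> h x s + h y t"
        using add[of "x + s *\<^sub>R a" "y + t *\<^sub>R a"] by (simp add: h_def algebra_simps)
      finally show ?thesis .
    qed
    then have "q (x + y) - h x s \<le> q y" if "s \<ge> 0" for s
      using that by (intro q_ge) (simp add: algebra_simps)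
    then have "q (x + y) - q y \<le> q x"
      by (intro q_ge) (simp add: algebra_simps)
    then show "q (x + y) \<le> q x + q y" by simp
  next
    fix c :: real and x assume c: "c > 0"
    have "q (c *\<^sub>R x) / c \<le> h x t" if "t \<ge> 0" for t
    proof -
      have "q (c *\<^sub>R x) \<le> h (c *\<^sub>R x) (c * t)" using q_le that c by simp
      also have "\<dots> = c * h x t"
        using hom[of c "x + t *\<^sub>R a"] c by (simp add: h_def algebra_simps)
      finally show ?thesis using c by (simp add: field_simps)
    qed
    then have "q (c *\<^sub>R x) / c \<le> q x" by (rule q_ge)
    then show "q (c *\<^sub>R x) \<le> c * q x" using c by (simp add: field_simps)
  next
    have "h 0 t = 0" if "t \<ge> 0" for t using hom[OF that, of a] by (simp add: h_def)
    then show "q 0 = 0" by (intro antisym q_ge) (use q_le[of 0 0] in auto)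
  qed
  moreover have "q x \<le> p x" for x using q_le[of 0 x] by (simp add: h_def)
  moreover have "q (- a) \<le> - p a"
    using q_le[of 1 "- a"] hom[of 0 a] by (simp add: h_def)
  ultimately show thesis using that by blast
qed

text \<open>
Hahn--Banach without extending functionals step by step from a subspace: Zorn's lemma gives a
minimal sublinear function below \<open>p\<close>, and minimal sublinear functions are linear.
\<close>

lemma Hahn_Banach_sublinear:
  assumes p: "sublinear p"
  obtains f :: "'a::real_vector \<Rightarrow> real" where "linear f" "\<And>x. f x \<le> p x" "f a = p a"
proof -
  obtain p' where p': "sublinear p'" "\<And>x. p' x \<le> p x" "p' (- a) \<le> - p a"
    using sublinear_descent[OF p] by blast
  define Q where "Q = {q. sublinear q \<and> q \<le> p'}"
  have "\<exists>m\<in>Q. \<forall>q\<in>Q. q \<le> m \<longrightarrow> q = m"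
  proof (rule predicate_Zorn)
    show "partial_order_on Q (relation_of (\<lambda>m q. q \<le> m) Q)"
      by (auto simp: partial_order_on_def preorder_on_def refl_on_def trans_def antisym_def relation_of_def)
    fix C assume "C \<in> Chains (relation_of (\<lambda>m q. q \<le> m) Q)"
    then have CQ: "C \<subseteq> Q" and chain: "\<And>q r. q \<in> C \<Longrightarrow> r \<in> C \<Longrightarrow> q \<le> r \<or> r \<le> q"
      by (auto simp: Chains_def relation_of_def)
    show "\<exists>u\<in>Q. \<forall>q\<in>C. u \<le> q"
    proof (cases "C = {}")
      case True
      then show ?thesis using p'(1) by (auto simp: Q_def)
    next
      case False
      define u where "u x = (INF q\<in>C. q x)" for x
      have lb: "- p' (- x) \<le> q x" if "q \<in> C" for q x
      proof -
        have "sublinear q" "q (- x) \<le> p' (- x)" using that CQ by (auto simp: Q_def le_fun_def)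
        with sublinear_lower_bound[of q x] show ?thesis by simp
      qed
      have u_le: "u x \<le> q x" if "q \<in> C" for q x
        unfolding u_def by (rule cINF_lower) (use that lb[of _ x] in \<open>auto intro!: bdd_belowI2\<close>)
      have u_ge: "m \<le> u x" if "\<And>q. q \<in> C \<Longrightarrow> m \<le> q x" for m x
        unfolding u_def by (rule cINF_greatest) (use False that in auto)
      have sub: "sublinear q" if "q \<in> C" for q using that CQ by (auto simp: Q_def)
      have "sublinear u"
      proof (rule sublinearI)
        fix x y
        have "u (x + y) \<le> q x + r y" if qr: "q \<in> C" "r \<in> C" for q r
        proof -
          obtain m where m: "m \<in> C" "m \<le> q" "m \<le> r" by (metis order_refl chain qr)
          have "u (x + y) \<le> m (x + y)" using u_le m by blast
          also have "\<dots> \<le> m x + m y" using sub[OF m(1)] by (simp add: sublinear_def)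
          also have "\<dots> \<le> q x + r y" using m by (simp add: le_fun_def add_mono)
          finally show ?thesis .
        qed
        then have "u (x + y) - q x \<le> u y" if "q \<in> C" for q
          using that by (intro u_ge) (metis add.commute diff_le_eq)
        then have "u (x + y) - u y \<le> u x"
          by (intro u_ge) (metis add.commute diff_le_eq)
        then show "u (x + y) \<le> u x + u y" by simp
      next
        fix c :: real and x assume c: "c > 0"
        have "u (c *\<^sub>R x) / c \<le> q x" if "q \<in> C" for q
          using u_le[OF that, of "c *\<^sub>R x"] sub[OF that] c by (simp add: sublinear_def field_simps)
        then have "u (c *\<^sub>R x) / c \<le> u x" by (rule u_ge)
        then show "u (c *\<^sub>R x) \<le> c * u x" using c by (simp add: field_simps)
      next
        have "q 0 = 0" if "q \<in> C" for q
          using sub[OF that] unfolding sublinear_def by (metis mult_zero_left order_refl scaleR_zero_left)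
        then have "(\<lambda>q. q 0) ` C = {0}" using False by force
        then show "u 0 = 0" by (simp add: u_def)
      qed
      moreover have "u \<le> p'"
      proof -
        obtain q where q: "q \<in> C" using False by blast
        then have "q \<le> p'" using CQ by (auto simp: Q_def)
        with u_le[OF q] show ?thesis by (meson le_fun_def order_trans)
      qed
      ultimately show ?thesis using u_le by (auto simp: Q_def le_fun_def)
    qed
  qed
  then obtain f where f: "sublinear f" "f \<le> p'" and min: "\<And>q. sublinear q \<Longrightarrow> q \<le> f \<Longrightarrow> q = f"
    by (auto simp: Q_def intro: order_trans)
  have neg: "f (- x) = - f x" for x
  proof -
    obtain q where "sublinear q" "\<And>y. q y \<le> f y" "q (- x) \<le> - f x"
      using sublinear_descent[OF f(1)] by blast
    then have "f (- x) \<le> - f x" using min[of q] by (simp add: le_fun_def)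
    with sublinear_lower_bound[OF f(1), of x] show ?thesis by simp
  qed
  have add: "f (x + y) \<le> f x + f y" and hom: "c \<ge> 0 \<Longrightarrow> f (c *\<^sub>R x) = c * f x" for x y c
    using f by (auto simp: sublinear_def)
  have "linear f"
  proof (rule linearI)
    show "f (x + y) = f x + f y" for x y
      using add[of x y] add[of "x + y" "- y"] neg[of y] by simp
    show "f (c *\<^sub>R x) = c *\<^sub>R f x" for c x
      using hom[of c x] hom[of "- c" x] neg[of "c *\<^sub>R x"] by (cases "c \<ge> 0") auto
  qed
  moreover have le: "f x \<le> p x" for x using f(2) p'(2) by (meson le_fun_def order_trans)
  moreover have "f a = p a"
  proof (rule antisym)
    have "f (- a) \<le> - p a" using f(2) p'(3) by (meson le_fun_def order_trans)
    then show "p a \<le> f a" using neg[of a] by simp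
  qed (rule le)
  ultimately show thesis using that by blast
qed

lemma norming_functional:
  obtains f :: "'a::real_normed_vector \<Rightarrow>\<^sub>L real" where "norm f \<le> 1" "blinfun_apply f a = norm a"
proof -
  have "sublinear (norm :: 'a \<Rightarrow> real)" by (simp add: sublinear_def norm_triangle_ineq)
  then obtain g :: "'a \<Rightarrow> real" where g: "linear g" "\<And>x. g x \<le> norm x" "g a = norm a"
    using Hahn_Banach_sublinear by blast
  have b: "norm (g x) \<le> norm x * 1" for x
    using g(2)[of x] g(2)[of "- x"] by (simp add: linear_neg[OF g(1)])
  have bl: "bounded_linear g"
    using g(1) b by (intro bounded_linear_intro[of g 1]) (auto simp: linear_add linear_scale)
  have "norm (Blinfun g) \<le> 1"
    using b by (intro norm_blinfun_bound) (auto simp: bounded_linear_Blinfun_apply[OF bl])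
  moreover have "blinfun_apply (Blinfun g) a = norm a"
    by (simp add: bounded_linear_Blinfun_apply[OF bl] g(3))
  ultimately show thesis using that by blast
qed

text \<open>
The distance to a subspace is sublinear, vanishes on the subspace and is positive off its closure,
so a linear functional below it that agrees with it at \<open>a\<close> separates.
\<close>

lemma separating_functional_subspace:
  fixes V :: "'a::real_normed_vector set"
  assumes V: "subspace V" and a: "a \<notin> closure V"
  obtains f :: "'a \<Rightarrow>\<^sub>L real" where "\<And>v. v \<in> V \<Longrightarrow> blinfun_apply f v = 0" "blinfun_apply f a \<noteq> 0"
proof -
  have ne: "V \<noteq> {}" using subspace_0[OF V] by blast
  have le: "infdist x V \<le> norm (x - v)" if "v \<in> V" for x v
    using infdist_le[OF that, of x] by (simp add: dist_norm)
  have ge: "m \<le> infdist x V" if "\<And>v. v \<in> V \<Longrightarrow> m \<le> norm (x - v)" for m x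
    unfolding infdist_def using ne that by (auto simp: dist_norm intro!: cINF_greatest)
  have "sublinear (\<lambda>x. infdist x V)"
  proof (rule sublinearI)
    fix x y
    have "infdist (x + y) V \<le> norm (x - v) + norm (y - w)" if "v \<in> V" "w \<in> V" for v w
    proof -
      have "infdist (x + y) V \<le> norm (x + y - (v + w))" using le subspace_add[OF V that] by blast
      also have "\<dots> \<le> norm (x - v) + norm (y - w)" using norm_triangle_ineq[of "x - v" "y - w"] by (simp add: algebra_simps)
      finally show ?thesis .
    qed
    then have "infdist (x + y) V - norm (x - v) \<le> infdist y V" if "v \<in> V" for v
      using that by (intro ge) (simp add: algebra_simps)
    then have "infdist (x + y) V - infdist y V \<le> infdist x V"
      by (intro ge) (simp add: algebra_simps)
    then show "infdist (x + y) V \<le> infdist x V + infdist y V" by simp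
  next
    fix c :: real and x assume c: "c > 0"
    have "infdist (c *\<^sub>R x) V / c \<le> norm (x - v)" if "v \<in> V" for v
    proof -
      have "infdist (c *\<^sub>R x) V \<le> norm (c *\<^sub>R x - c *\<^sub>R v)" using le subspace_scale[OF V that] by blast
      also have "\<dots> = c * norm (x - v)" using c by (simp flip: scaleR_diff_right)
      finally show ?thesis using c by (simp add: field_simps)
    qed
    then have "infdist (c *\<^sub>R x) V / c \<le> infdist x V" by (rule ge)
    then show "infdist (c *\<^sub>R x) V \<le> c * infdist x V" using c by (simp add: field_simps)
  next
    show "infdist 0 V = 0" using subspace_0[OF V] by simp
  qed
  then obtain g where g: "linear g" "\<And>x. g x \<le> infdist x V" "g a = infdist a V"
    using Hahn_Banach_sublinear by blast
  have "g x \<le> norm x" for x using g(2)[of x] le[OF subspace_0[OF V], of x] by simp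
  from this this[of "- x" for x] have b: "norm (g x) \<le> norm x * 1" for x
    by (simp add: linear_neg[OF g(1)] abs_le_iff)
  have bl: "bounded_linear g"
    using g(1) b by (intro bounded_linear_intro[of g 1]) (auto simp: linear_add linear_scale)
  show thesis
  proof (rule that[of "Blinfun g"])
    fix v assume v: "v \<in> V"
    have "g v \<le> 0" "g (- v) \<le> 0" using g(2)[of v] g(2)[of "- v"] v subspace_neg[OF V v] by auto
    then show "blinfun_apply (Blinfun g) v = 0"
      by (simp add: bounded_linear_Blinfun_apply[OF bl] linear_neg[OF g(1)])
  next
    show "blinfun_apply (Blinfun g) a \<noteq> 0"
      using a ne g(3) by (simp add: bounded_linear_Blinfun_apply[OF bl] in_closure_iff_infdist_zero)
  qed
qed

section \<open>The weak topology\<close>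

lemma continuous_map_weak_functional:
  "continuous_map weak_topology euclideanreal (blinfun_apply f)"
proof -
  have "openin weak_topology {x. blinfun_apply f x \<in> U}" if "open U" for U
    unfolding weak_topology_def
    by (rule topology_generated_by_Basis) (use that in \<open>auto simp: vimage_def\<close>)
  then show ?thesis by (simp add: continuous_map_def)
qed

lemma continuous_map_into_weak:
  assumes "\<And>f :: 'a::real_normed_vector \<Rightarrow>\<^sub>L real. continuous_map X euclideanreal (\<lambda>x. blinfun_apply f (h x))"
  shows "continuous_map X weak_topology h"
  unfolding weak_topology_def
proof (rule continuous_on_generated_topo)
  fix W assume "W \<in> {blinfun_apply f -` U |(f :: 'a \<Rightarrow>\<^sub>L real) U. open U}"
  then obtain f :: "'a \<Rightarrow>\<^sub>L real" and U where W: "W = blinfun_apply f -` U" "open U" by blast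
  have "openin X {x \<in> topspace X. blinfun_apply f (h x) \<in> U}"
    using openin_continuous_map_preimage[OF assms] W(2) by auto
  also have "{x \<in> topspace X. blinfun_apply f (h x) \<in> U} = h -` W \<inter> topspace X" using W(1) by auto
  finally show "openin X (h -` W \<inter> topspace X)" .
next
  show "h ` topspace X \<subseteq> \<Union> {blinfun_apply f -` U |(f :: 'a \<Rightarrow>\<^sub>L real) U. open U}"
    using topspace_weak_topology[where 'a = 'a] by (auto simp: weak_topology_def topology_generated_by_topspace)
qed

lemma closedin_weak_functional:
  fixes f :: "'a::real_normed_vector \<Rightarrow>\<^sub>L real"
  shows "closed U \<Longrightarrow> closedin weak_topology {x. blinfun_apply f x \<in> U}"
  using closedin_continuous_map_preimage[OF continuous_map_weak_functional, of U f] by simp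

lemma Hausdorff_weak_topology: "Hausdorff_space (weak_topology :: 'a::real_normed_vector topology)"
  unfolding Hausdorff_space_def
proof (intro allI impI)
  fix x y :: 'a assume "x \<in> topspace weak_topology \<and> y \<in> topspace weak_topology \<and> x \<noteq> y"
  then obtain f :: "'a \<Rightarrow>\<^sub>L real" where "blinfun_apply f (x - y) \<noteq> 0"
    by (metis norming_functional norm_eq_zero right_minus_eq)
  then have "blinfun_apply f x \<noteq> blinfun_apply f y" by (simp add: blinfun.diff_right)
  from hausdorff[OF this] obtain U V
    where UV: "open U" "open V" "blinfun_apply f x \<in> U" "blinfun_apply f y \<in> V" "U \<inter> V = {}"
    by auto
  have "openin weak_topology {z. blinfun_apply f z \<in> W}" if "open W" for W
    using openin_continuous_map_preimage[OF continuous_map_weak_functional, of W f] that by simp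
  with UV show "\<exists>U V. openin weak_topology U \<and> openin weak_topology V \<and> x \<in> U \<and> y \<in> V \<and> disjnt U V"
    by (intro exI[of _ "{z. blinfun_apply f z \<in> U}"] exI[of _ "{z. blinfun_apply f z \<in> V}"])
       (auto simp: disjnt_def)
qed

lemma norm_le_iff_functionals:
  fixes x :: "'a::real_normed_vector"
  shows "norm x \<le> r \<longleftrightarrow> (\<forall>f :: 'a \<Rightarrow>\<^sub>L real. norm f \<le> 1 \<longrightarrow> blinfun_apply f x \<le> r)"
proof safe
  fix f :: "'a \<Rightarrow>\<^sub>L real" assume "norm x \<le> r" "norm f \<le> 1"
  have "blinfun_apply f x \<le> norm f * norm x" using norm_blinfun[of f x] by simp
  also have "\<dots> \<le> norm x" using \<open>norm f \<le> 1\<close> by (simp add: mult_left_le_one_le)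
  finally show "blinfun_apply f x \<le> r" using \<open>norm x \<le> r\<close> by simp
next
  assume "\<forall>f :: 'a \<Rightarrow>\<^sub>L real. norm f \<le> 1 \<longrightarrow> blinfun_apply f x \<le> r"
  then show "norm x \<le> r" by (metis norming_functional)
qed

text \<open>
Weak lower semicontinuity of the norm: balls are intersections of half-spaces.
\<close>

lemma closedin_weak_cball:
  fixes a :: "'a::real_normed_vector"
  shows "closedin weak_topology (cball a r)"
proof -
  have "cball a r = (\<Inter>f \<in> {f :: 'a \<Rightarrow>\<^sub>L real. norm f \<le> 1}. {x. blinfun_apply f x \<in> {..r + blinfun_apply f a}})"
  proof -
    have "x \<in> cball a r \<longleftrightarrow> norm (x - a) \<le> r" for x by (simp add: dist_norm norm_minus_commute)
    moreover have "blinfun_apply f (x - a) \<le> r \<longleftrightarrow> blinfun_apply f x \<in> {..r + blinfun_apply f a}"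
      for f :: "'a \<Rightarrow>\<^sub>L real" and x by (simp add: blinfun.diff_right diff_le_eq)
    ultimately show ?thesis
      unfolding norm_le_iff_functionals[of "_ - a"] by blast
  qed
  moreover have "{f :: 'a \<Rightarrow>\<^sub>L real. norm f \<le> 1} \<noteq> {}" by (auto intro: exI[of _ 0])
  moreover have "closedin weak_topology {x. blinfun_apply f x \<in> {..r + blinfun_apply f a}}" for f :: "'a \<Rightarrow>\<^sub>L real"
    by (rule closedin_weak_functional) simp
  ultimately show ?thesis
    by (simp only:) (rule closedin_Inter, blast+)
qed

lemma closedin_weak_closure_subspace:
  fixes V :: "'a::real_normed_vector set"
  assumes "subspace V"
  shows "closedin weak_topology (closure V)"
proof -
  define F where "F = {f :: 'a \<Rightarrow>\<^sub>L real. \<forall>v\<in>V. blinfun_apply f v = 0}"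
  have "closure V = (\<Inter>f\<in>F. {x. blinfun_apply f x \<in> {0}})"
  proof safe
    fix x f assume x: "x \<in> closure V" and f: "f \<in> F"
    have "continuous_on UNIV (blinfun_apply f)" by (intro continuous_intros)
    then have "closed {x. blinfun_apply f x = 0}" by (intro closed_Collect_eq) (auto intro: continuous_intros)
    moreover have "V \<subseteq> {x. blinfun_apply f x = 0}" using f by (auto simp: F_def)
    ultimately show "blinfun_apply f x = 0" using x closure_minimal by blast
  next
    fix x assume x: "x \<in> (\<Inter>f\<in>F. {x. blinfun_apply f x \<in> {0}})"
    show "x \<in> closure V"
    proof (rule ccontr)
      assume "x \<notin> closure V"
      then obtain f :: "'a \<Rightarrow>\<^sub>L real" where "\<And>v. v \<in> V \<Longrightarrow> blinfun_apply f v = 0" "blinfun_apply f x \<noteq> 0"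
        using separating_functional_subspace[OF assms] by metis
      with x show False by (auto simp: F_def)
    qed
  qed
  moreover have "F \<noteq> {}" by (auto simp: F_def intro: exI[of _ 0])
  moreover have "closedin weak_topology {x. blinfun_apply f x \<in> {0}}" for f :: "'a \<Rightarrow>\<^sub>L real"
    by (rule closedin_weak_functional) simp
  ultimately show ?thesis
    by (simp only:) (rule closedin_Inter, blast+)
qed

section \<open>Chebyshev centers in L-embedded spaces\<close>

text \<open>
The last three claims say that the infimum defining the center behaves like a radius: it is
nonnegative, every larger \<open>\<rho>\<close> is the radius of a ball containing \<open>A\<close>, and no smaller one is. The
second claim feeds the compactness argument in the bidual, the third one excludes components
outside the space.
\<close>

lemma chebyshev_center_eq_INT_cball:
  fixes A :: "'a::real_normed_vector set"
  assumes "A \<noteq> {}" "bounded A"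
  defines "r \<equiv> (INF z. SUP y\<in>A. norm (z - y))"
  shows "chebyshev_center A = (\<Inter>y\<in>A. cball y r)"
    and "\<And>\<rho>. r < \<rho> \<Longrightarrow> (\<Inter>y\<in>A. cball y \<rho>) \<noteq> {}"
    and "\<And>x \<rho>. x \<in> (\<Inter>y\<in>A. cball y \<rho>) \<Longrightarrow> r \<le> \<rho>"
    and "r \<ge> 0"
proof -
  define R where "R z = (SUP y\<in>A. norm (z - y))" for z
  obtain b where b: "\<And>y. y \<in> A \<Longrightarrow> norm y \<le> b" using assms(2) by (auto simp: bounded_iff)
  have bdd: "bdd_above ((\<lambda>y. norm (z - y)) ` A)" for z
  proof (rule bdd_aboveI2)
    fix y assume "y \<in> A"
    then show "norm (z - y) \<le> norm z + b" using norm_triangle_ineq4[of z y] b[of y] by simp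
  qed
  have R_ge: "norm (z - y) \<le> R z" if "y \<in> A" for z y
    unfolding R_def using that bdd by (rule cSUP_upper)
  have R_le: "R z \<le> \<rho> \<longleftrightarrow> z \<in> (\<Inter>y\<in>A. cball y \<rho>)" for z \<rho>
    using cSUP_le_iff[OF assms(1) bdd, of z \<rho>] by (auto simp: R_def dist_norm norm_minus_commute)
  have R_nonneg: "R z \<ge> 0" for z using R_ge assms(1) norm_ge_zero by (meson ex_in_conv order_trans)
  then have bddR: "bdd_below (range R)" by (rule bdd_belowI2)
  have r: "r = (INF z. R z)" by (simp add: r_def R_def)
  have r_le: "r \<le> R z" for z unfolding r by (rule cINF_lower[OF bddR]) simp
  show "r \<ge> 0" unfolding r using R_nonneg by (intro cINF_greatest) auto
  show "chebyshev_center A = (\<Inter>y\<in>A. cball y r)"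
  proof -
    have "chebyshev_center A = {z. R z \<le> r}"
      unfolding chebyshev_center_def using r_le by (auto simp: R_def r_def[symmetric] intro: antisym)
    then show ?thesis using R_le by auto
  qed
  show "(\<Inter>y\<in>A. cball y \<rho>) \<noteq> {}" if lt: "r < \<rho>" for \<rho>
  proof -
    obtain z where "R z < \<rho>" using iffD1[OF cINF_less_iff[OF UNIV_not_empty bddR] lt[unfolded r]] by blast
    then show ?thesis using R_le[of z \<rho>] by (metis less_imp_le empty_iff)
  qed
  show "r \<le> \<rho>" if "x \<in> (\<Inter>y\<in>A. cball y \<rho>)" for x \<rho>
    using that r_le[of x] R_le[of x \<rho>] by simp
qed

text \<open>
The intersection over \<open>a \<in> A\<close> of the balls of radius \<open>\<rho>\<close> in the bidual, its elements being represented
by their underlying functions on the dual. In this form the weak* topology is the product topology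
that function types carry, and Tychonoff's theorem applies.
\<close>

definition bidual_balls :: "'a::real_normed_vector set \<Rightarrow> real \<Rightarrow> (('a \<Rightarrow>\<^sub>L real) \<Rightarrow> real) set" where
  "bidual_balls A \<rho> = {\<phi>. (\<forall>f g. \<phi> (f + g) = \<phi> f + \<phi> g) \<and> (\<forall>c f. \<phi> (c *\<^sub>R f) = c * \<phi> f) \<and>
     (\<forall>a\<in>A. \<forall>f. \<bar>\<phi> f - blinfun_apply f a\<bar> \<le> \<rho> * norm f)}"

lemma closed_bidual_balls: "closed (bidual_balls A \<rho>)"
proof -
  have "bidual_balls A \<rho> = {\<phi>. (\<forall>f g. \<phi> (f + g) = \<phi> f + \<phi> g) \<and> (\<forall>c f. \<phi> (c *\<^sub>R f) = c * \<phi> f)} \<inter>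
     (\<Inter>a\<in>A. {\<phi>. \<forall>f. \<bar>\<phi> f - blinfun_apply f a\<bar> \<le> \<rho> * norm f})"
    by (auto simp: bidual_balls_def)
  then show ?thesis
    by (simp only:) (intro closed_Int closed_INT ballI closed_Collect_conj closed_Collect_all
        closed_Collect_eq closed_Collect_le continuous_intros continuous_on_product_coordinates)
qed

text \<open>
Banach--Alaoglu for an intersection of balls: a closed subset of a product of compact intervals.
\<close>

lemma compact_bidual_balls:
  fixes A :: "'a::real_normed_vector set"
  assumes "A \<noteq> {}"
  shows "compact (bidual_balls A \<rho>)"
proof -
  obtain a where a: "a \<in> A" using assms by blast
  define P :: "(('a \<Rightarrow>\<^sub>L real) \<Rightarrow> real) set"
    where "P = PiE UNIV (\<lambda>f. {blinfun_apply f a - \<rho> * norm f .. blinfun_apply f a + \<rho> * norm f})"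
  have "compact P"
  proof -
    have "compactin (product_topology (\<lambda>_. euclideanreal) UNIV) P"
      unfolding P_def compactin_PiE by simp
    then show ?thesis by (simp only: euclidean_product_topology compactin_euclidean_iff)
  qed
  have "bidual_balls A \<rho> \<subseteq> P"
  proof
    fix \<phi> assume "\<phi> \<in> bidual_balls A \<rho>"
    then have "\<bar>\<phi> f - blinfun_apply f a\<bar> \<le> \<rho> * norm f" for f using a by (auto simp: bidual_balls_def)
    then show "\<phi> \<in> P" by (auto simp: P_def abs_le_iff algebra_simps)
  qed
  then show ?thesis
    using closed_Int_compact[OF closed_bidual_balls \<open>compact P\<close>] by (metis inf.absorb_iff1)
qed

text \<open>
The center of \<open>A\<close> in the bidual is weak* compact and is the image of the center in the space, as a
point \<open>x + \<xi>\<close> of it satisfies \<open>norm (x - a) + norm \<xi> \<le> r\<close> for all \<open>a \<in> A\<close>, which is incompatible with \<open>\<xi> \<noteq> 0\<close>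
by the choice of \<open>r\<close>. The weak* topology induces the weak topology on the space.
\<close>

lemma chebyshev_center_weakly_compact:
  fixes A :: "'a::real_normed_vector set"
  assumes L: "L_embedded TYPE('a)" and A: "A \<noteq> {}" "bounded A"
  shows "compactin weak_topology (chebyshev_center A)" and "chebyshev_center A \<noteq> {}"
proof -
  define r where "r = (INF z. SUP y\<in>A. norm (z - y))"
  note C = chebyshev_center_eq_INT_cball[OF A, folded r_def]
  define J :: "'a \<Rightarrow> ('a \<Rightarrow>\<^sub>L real) \<Rightarrow> real" where "J x f = blinfun_apply f x" for x f
  have J_in: "J x \<in> bidual_balls A \<rho>" if x: "x \<in> (\<Inter>y\<in>A. cball y \<rho>)" for x \<rho>
  proof -
    have "\<bar>blinfun_apply f x - blinfun_apply f a\<bar> \<le> \<rho> * norm f" if "a \<in> A" for a f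
    proof -
      have "\<bar>blinfun_apply f x - blinfun_apply f a\<bar> \<le> norm f * norm (x - a)"
        using norm_blinfun[of f "x - a"] by (simp add: blinfun.diff_right)
      also have "\<dots> \<le> norm f * \<rho>"
        using x that by (intro mult_left_mono) (auto simp: dist_norm norm_minus_commute)
      finally show ?thesis by (simp add: mult.commute)
    qed
    then show ?thesis by (simp add: bidual_balls_def J_def blinfun.add_left blinfun.scaleR_left)
  qed
  have in_J: "\<phi> \<in> J ` chebyshev_center A" if \<phi>: "\<phi> \<in> bidual_balls A r" for \<phi>
  proof -
    have lin: "\<phi> (f + g) = \<phi> f + \<phi> g" "\<phi> (c *\<^sub>R f) = c * \<phi> f" for f g c
      using \<phi> by (auto simp: bidual_balls_def)
    have bd: "\<bar>\<phi> f - blinfun_apply f a\<bar> \<le> r * norm f" if "a \<in> A" for a f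
      using \<phi> that by (auto simp: bidual_balls_def)
    obtain a0 where a0: "a0 \<in> A" using A by blast
    have bl: "bounded_linear \<phi>"
    proof (rule bounded_linear_intro[of _ "r + norm a0"])
      fix f
      have "\<bar>\<phi> f\<bar> \<le> \<bar>blinfun_apply f a0\<bar> + r * norm f" using bd[OF a0, of f] by linarith
      also have "\<bar>blinfun_apply f a0\<bar> \<le> norm f * norm a0" using norm_blinfun[of f a0] by simp
      finally show "norm (\<phi> f) \<le> norm f * (r + norm a0)" by (simp add: algebra_simps)
    qed (simp_all add: lin)
    define \<Phi> where "\<Phi> = Blinfun \<phi>"
    have \<Phi>: "blinfun_apply \<Phi> = \<phi>" by (simp add: \<Phi>_def bounded_linear_Blinfun_apply[OF bl])
    have dist: "norm (\<Phi> - bidual_embedding a) \<le> r" if "a \<in> A" for a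
      by (rule norm_blinfun_bound)
         (simp_all add: C(4) blinfun.diff_left \<Phi> bidual_embedding.rep_eq bd[OF that])
    obtain x \<xi> where \<Phi>_eq: "\<Phi> = bidual_embedding x + \<xi>"
      and split: "\<And>z :: 'a. norm (bidual_embedding z + \<xi>) = norm z + norm \<xi>"
      using L unfolding L_embedded_def by (smt (verit, best) UNIV_I mem_Collect_eq)
    have emb_diff: "bidual_embedding x - bidual_embedding a = bidual_embedding (x - a)" for a
      by (rule blinfun_eqI) (simp add: blinfun.diff_left bidual_embedding.rep_eq blinfun.diff_right)
    have "norm (x - a) + norm \<xi> \<le> r" if "a \<in> A" for a
      using dist[OF that] split[of "x - a"] emb_diff[of a] by (simp add: \<Phi>_eq algebra_simps)
    then have x: "x \<in> (\<Inter>y\<in>A. cball y (r - norm \<xi>))"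
      by (force simp: dist_norm norm_minus_commute)
    with C(3) have "\<xi> = 0" by fastforce
    with x have "x \<in> chebyshev_center A" by (simp add: C(1))
    moreover have "\<phi> = J x" using \<Phi> \<Phi>_eq \<open>\<xi> = 0\<close> by (auto simp: J_def fun_eq_iff bidual_embedding.rep_eq)
    ultimately show ?thesis by blast
  qed
  have image: "J ` chebyshev_center A = bidual_balls A r"
    using in_J J_in C(1) by auto
  have "inj J"
  proof (rule injI)
    fix x y assume "J x = J y"
    then have "blinfun_apply f (x - y) = 0" for f :: "'a \<Rightarrow>\<^sub>L real" by (simp add: J_def fun_eq_iff blinfun.diff_right)
    then show "x = y" by (metis norming_functional norm_eq_zero right_minus_eq)
  qed
  have "continuous_map (top_of_set (bidual_balls A r)) weak_topology (inv J)"
  proof (rule continuous_map_into_weak)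
    fix f :: "'a \<Rightarrow>\<^sub>L real"
    have "continuous_map (top_of_set (bidual_balls A r)) euclideanreal (\<lambda>\<phi>. \<phi> f)"
      using continuous_on_subset[OF continuous_on_product_coordinates subset_UNIV] by simp
    moreover have "\<phi> f = blinfun_apply f (inv J \<phi>)" if "\<phi> \<in> bidual_balls A r" for \<phi>
      using that \<open>inj J\<close> by (auto simp flip: image simp: J_def)
    ultimately show "continuous_map (top_of_set (bidual_balls A r)) euclideanreal (\<lambda>\<phi>. blinfun_apply f (inv J \<phi>))"
      by (rule continuous_map_eq) simp
  qed
  then have "compactin weak_topology (inv J ` bidual_balls A r)"
    by (rule image_compactin[rotated]) (simp add: compactin_subtopology compact_bidual_balls[OF A(1)])
  then show "compactin weak_topology (chebyshev_center A)"
    using \<open>inj J\<close> by (simp flip: image add: image_image)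
  \<comment> \<open>At radius \<open>r\<close> itself nonemptiness is a limit of nonempty compact sets of radii \<open>\<rho> > r\<close>.\<close>
  have "bidual_balls A r \<noteq> {}"
  proof -
    have "bidual_balls A (r + 1) \<inter> (\<Inter>\<rho>\<in>{r<..}. bidual_balls A \<rho>) \<noteq> {}"
    proof (rule compact_imp_fip_image)
      show "compact (bidual_balls A (r + 1))" using compact_bidual_balls[OF A(1)] .
      show "closed (bidual_balls A \<rho>)" for \<rho> by (rule closed_bidual_balls)
      fix I assume I: "finite I" "I \<subseteq> {r<..}"
      define m where "m = Min (insert (r + 1) I)"
      have m: "m \<le> \<rho>" if "\<rho> \<in> insert (r + 1) I" for \<rho> using I(1) that by (simp add: m_def)
      have "r < m" using I by (auto simp: m_def)
      then obtain x where "x \<in> (\<Inter>y\<in>A. cball y m)" using C(2) by blast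
      then have "x \<in> (\<Inter>y\<in>A. cball y \<rho>)" if "\<rho> \<in> insert (r + 1) I" for \<rho>
        using m[OF that] by (auto intro: order_trans)
      then have "J x \<in> bidual_balls A \<rho>" if "\<rho> \<in> insert (r + 1) I" for \<rho>
        using J_in that by blast
      then show "bidual_balls A (r + 1) \<inter> (\<Inter>\<rho>\<in>I. bidual_balls A \<rho>) \<noteq> {}" by auto
    qed
    then obtain \<phi> where "\<phi> \<in> bidual_balls A (r + 1) \<inter> (\<Inter>\<rho>\<in>{r<..}. bidual_balls A \<rho>)"
      by (meson ex_in_conv)
    then have \<phi>: "\<phi> \<in> bidual_balls A \<rho>" if "r < \<rho>" for \<rho> using that by simp
    have "\<bar>\<phi> f - blinfun_apply f a\<bar> \<le> r * norm f" if "a \<in> A" for a f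
    proof (rule field_le_epsilon)
      fix e :: real assume "e > 0"
      define d where "d = e / (norm f + 1)"
      have "norm f + 1 > 0" using norm_ge_zero[of f] by linarith
      then have "d > 0" "d * norm f \<le> e" using \<open>e > 0\<close> by (auto simp: d_def field_simps)
      then have "\<bar>\<phi> f - blinfun_apply f a\<bar> \<le> (r + d) * norm f"
        using \<phi>[of "r + d"] that by (auto simp: bidual_balls_def)
      with \<open>d * norm f \<le> e\<close> show "\<bar>\<phi> f - blinfun_apply f a\<bar> \<le> r * norm f + e" by (simp add: algebra_simps)
    qed
    then have "\<phi> \<in> bidual_balls A r" using \<phi>[of "r + 1"] by (auto simp: bidual_balls_def)
    then show ?thesis by blast
  qed
  then show "chebyshev_center A \<noteq> {}" using image by blast
qed

section \<open>Compact semigroups and distal flows\<close>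

text \<open>
Zorn's lemma; chains have lower bounds by the finite intersection property. The property \<open>P\<close> stands
for being a subsemigroup, an invariant set or a convex invariant set.
\<close>

lemma compact_minimal_closed_subset:
  assumes K: "compactin X K" "closedin X K" "K \<noteq> {}" "P K"
    and P_Inter: "\<And>\<C>. \<C> \<noteq> {} \<Longrightarrow> (\<And>C. C \<in> \<C> \<Longrightarrow> P C) \<Longrightarrow> P (\<Inter>\<C>)"
  obtains M where "M \<subseteq> K" "closedin X M" "M \<noteq> {}" "P M"
    "\<And>N. N \<subseteq> M \<Longrightarrow> closedin X N \<Longrightarrow> N \<noteq> {} \<Longrightarrow> P N \<Longrightarrow> N = M"
proof -
  define Q where "Q = {M. M \<subseteq> K \<and> closedin X M \<and> M \<noteq> {} \<and> P M}"
  have "\<exists>M\<in>Q. \<forall>N\<in>Q. N \<subseteq> M \<longrightarrow> N = M"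
  proof (rule predicate_Zorn)
    show "partial_order_on Q (relation_of (\<lambda>M N. N \<subseteq> M) Q)"
      by (auto simp: partial_order_on_def preorder_on_def refl_on_def trans_def antisym_def relation_of_def)
    fix \<C> assume "\<C> \<in> Chains (relation_of (\<lambda>M N. N \<subseteq> M) Q)"
    then have CQ: "\<C> \<subseteq> Q" and chain: "\<And>M N. M \<in> \<C> \<Longrightarrow> N \<in> \<C> \<Longrightarrow> M \<subseteq> N \<or> N \<subseteq> M"
      by (auto simp: Chains_def relation_of_def)
    show "\<exists>U\<in>Q. \<forall>M\<in>\<C>. U \<subseteq> M"
    proof (cases "\<C> = {}")
      case True
      then show ?thesis using K by (auto simp: Q_def)
    next
      case False
      have least: "\<exists>m\<in>\<C>. \<forall>c\<in>\<F>. m \<subseteq> c" if "finite \<F>" "\<F> \<subseteq> \<C>" for \<F>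
        using that
      proof (induction \<F>)
        case empty
        then show ?case using False by blast
      next
        case (insert c \<F>)
        then obtain m where m: "m \<in> \<C>" "\<forall>c\<in>\<F>. m \<subseteq> c" by auto
        have "c \<in> \<C>" using insert.prems by simp
        from chain[OF this m(1)] show ?case
        proof
          assume "c \<subseteq> m"
          with m(2) \<open>c \<in> \<C>\<close> show ?thesis by (intro bexI[of _ c]) auto
        next
          assume "m \<subseteq> c"
          with m show ?thesis by (intro bexI[of _ m]) auto
        qed
      qed
      have "K \<inter> \<Inter>\<F> \<noteq> {}" if \<F>: "finite \<F>" "\<F> \<subseteq> \<C>" for \<F>
      proof -
        obtain m where "m \<in> \<C>" and m: "\<forall>c\<in>\<F>. m \<subseteq> c" using least[OF \<F>] by blast
        then have "m \<subseteq> K" "m \<noteq> {}" using CQ by (auto simp: Q_def)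
        moreover have "m \<subseteq> \<Inter>\<F>" using m by (simp add: Inter_greatest)
        ultimately show ?thesis by (metis inf_greatest subset_empty)
      qed
      then have "K \<inter> \<Inter>\<C> \<noteq> {}"
      proof -
        have "\<forall>C\<in>\<C>. closedin X C" using CQ by (auto simp: Q_def)
        with \<open>\<And>\<F>. finite \<F> \<Longrightarrow> \<F> \<subseteq> \<C> \<Longrightarrow> K \<inter> \<Inter>\<F> \<noteq> {}\<close> show ?thesis
          using K(1)[unfolded compactin_fip, THEN conjunct2, rule_format, of \<C>] by simp
      qed
      then have "\<Inter>\<C> \<noteq> {}" by auto
      moreover have "closedin X (\<Inter>\<C>)" using CQ False by (auto simp: Q_def intro!: closedin_Inter)
      moreover have "P (\<Inter>\<C>)" using CQ False by (auto simp: Q_def intro!: P_Inter)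
      moreover have "\<Inter>\<C> \<subseteq> K" using CQ False by (auto simp: Q_def)
      ultimately have "\<Inter>\<C> \<in> Q" by (simp add: Q_def)
      then show ?thesis by blast
    qed
  qed
  then obtain M where "M \<in> Q" and "\<And>N. N \<in> Q \<Longrightarrow> N \<subseteq> M \<Longrightarrow> N = M" by blast
  then show thesis by (intro that[of M]) (auto simp: Q_def)
qed

text \<open>
Ellis--Numakura: in a minimal closed subsemigroup \<open>H\<close> one has \<open>H u = H\<close> for each \<open>u \<in> H\<close>, so the closed
subsemigroup \<open>{p \<in> H. p u = u}\<close> is nonempty and again everything; in particular it contains \<open>u\<close>.
\<close>

lemma compact_right_topological_semigroup_idempotent:
  assumes T: "Hausdorff_space T" "compact_space T" "topspace T \<noteq> {}"
    and closed: "\<And>p q. p \<in> topspace T \<Longrightarrow> q \<in> topspace T \<Longrightarrow> mul p q \<in> topspace T"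
    and assoc: "\<And>p q r. p \<in> topspace T \<Longrightarrow> q \<in> topspace T \<Longrightarrow> r \<in> topspace T \<Longrightarrow>
      mul (mul p q) r = mul p (mul q r)"
    and cont: "\<And>q. q \<in> topspace T \<Longrightarrow> continuous_map T T (\<lambda>p. mul p q)"
  obtains u where "u \<in> topspace T" "mul u u = u"
proof -
  define P where "P H \<longleftrightarrow> (\<forall>p\<in>H. \<forall>q\<in>H. mul p q \<in> H)" for H
  have "compactin T (topspace T)" "P (topspace T)" using T closed by (auto simp: compact_space_def P_def)
  moreover have "P (\<Inter>\<C>)" if "\<And>C. C \<in> \<C> \<Longrightarrow> P C" for \<C> using that by (auto simp: P_def)
  ultimately obtain H where H: "H \<subseteq> topspace T" "closedin T H" "H \<noteq> {}" "P H"
    and min: "\<And>N. N \<subseteq> H \<Longrightarrow> closedin T N \<Longrightarrow> N \<noteq> {} \<Longrightarrow> P N \<Longrightarrow> N = H"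
    using compact_minimal_closed_subset[of T "topspace T" P] T(3) by (metis closedin_topspace)
  obtain u where u: "u \<in> H" using H by blast
  have mul_H: "mul p q \<in> H" if "p \<in> H" "q \<in> H" for p q using that H(4) by (auto simp: P_def)
  have assoc_H: "mul (mul p q) r = mul p (mul q r)" if "p \<in> H" "q \<in> H" "r \<in> H" for p q r
    using that H(1) assoc by blast
  have cont_u: "continuous_map T T (\<lambda>p. mul p u)" using cont u H(1) by blast
  \<comment> \<open>The left ideal \<open>H u\<close> is itself a closed subsemigroup of \<open>H\<close>.\<close>
  have "(\<lambda>p. mul p u) ` H = H"
  proof (rule min)
    show "closedin T ((\<lambda>p. mul p u) ` H)"
      using closedin_compact_space[OF T(2) H(2)] cont_u T(1) by (metis compactin_imp_closedin image_compactin)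
    show "P ((\<lambda>p. mul p u) ` H)"
      unfolding P_def
    proof safe
      fix p q assume pq: "p \<in> H" "q \<in> H"
      then have "mul (mul p u) (mul q u) = mul (mul (mul p u) q) u"
        using assoc_H[of "mul p u" q u] mul_H u by metis
      then show "mul (mul p u) (mul q u) \<in> (\<lambda>p. mul p u) ` H" using mul_H pq u by blast
    qed
  qed (use mul_H u in auto)
  then obtain q where q: "q \<in> H" "mul q u = u" using u by (metis imageE)
  have "{p \<in> H. mul p u = u} = H"
  proof (rule min)
    have "closedin T {p \<in> topspace T. mul p u = u}"
      using u H(1) by (intro closedin_continuous_maps_eq[OF T(1) cont_u]) auto
    then have "closedin T (H \<inter> {p \<in> topspace T. mul p u = u})" using H(2) by blast
    also have "H \<inter> {p \<in> topspace T. mul p u = u} = {p \<in> H. mul p u = u}" using H(1) by blast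
    finally show "closedin T {p \<in> H. mul p u = u}" .
    show "P {p \<in> H. mul p u = u}"
      using mul_H assoc_H u by (auto simp: P_def)
  qed (use q in auto)
  then have "mul u u = u" using u by blast
  then show thesis using that u H(1) by blast
qed

text \<open>
The Ellis semigroup of the flow of \<open>G\<close> on \<open>Y\<close>: the closure of \<open>G\<close> in the space of all self-maps of \<open>Y\<close> under
pointwise convergence. Maps are restricted to the space, so that the product is taken over its
points only and is compact whenever \<open>Y\<close> is.
\<close>

definition enveloping_semigroup :: "'a topology \<Rightarrow> ('a \<Rightarrow> 'a) set \<Rightarrow> ('a \<Rightarrow> 'a) set" where
  "enveloping_semigroup Y G =
     product_topology (\<lambda>_. Y) (topspace Y) closure_of ((\<lambda>g. restrict g (topspace Y)) ` G)"

text \<open>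
The hypothesis \<open>inj\<close> is distality of the flow. An idempotent \<open>u\<close> that is injective is the identity, since
\<open>u (u x) = u x\<close>. The compact left ideal \<open>E g\<close> contains an idempotent, so every \<open>g \<in> E\<close> has a left inverse
in \<open>E\<close>; a left inverse of the left inverse must then be \<open>g\<close> itself, so the left inverse is two-sided.
\<close>

lemma enveloping_semigroup_inverse:
  assumes Y: "compact_space Y" "Hausdorff_space Y"
    and cont: "\<And>g. g \<in> G \<Longrightarrow> continuous_map Y Y g"
    and comp: "\<And>g h. g \<in> G \<Longrightarrow> h \<in> G \<Longrightarrow> g \<circ> h \<in> G"
    and inj: "\<And>p. p \<in> enveloping_semigroup Y G \<Longrightarrow> inj_on p (topspace Y)"
    and g: "g \<in> enveloping_semigroup Y G"
  obtains p where "p \<in> enveloping_semigroup Y G"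
    "\<And>x. x \<in> topspace Y \<Longrightarrow> p (g x) = x" "\<And>x. x \<in> topspace Y \<Longrightarrow> g (p x) = x"
proof -
  define M where "M = topspace Y"
  define \<Omega> where "\<Omega> = product_topology (\<lambda>_::'a. Y) M"
  define G' where "G' = (\<lambda>g. restrict g M) ` G"
  define E where "E = enveloping_semigroup Y G"
  have E: "E = \<Omega> closure_of G'" unfolding E_def enveloping_semigroup_def \<Omega>_def G'_def M_def by (rule refl)
  have top_\<Omega>: "topspace \<Omega> = M \<rightarrow>\<^sub>E M" by (simp add: \<Omega>_def M_def)
  have \<Omega>: "compact_space \<Omega>" "Hausdorff_space \<Omega>"
    using Y by (auto simp: \<Omega>_def compact_space_product_topology Hausdorff_space_product_topology)
  have E_sub: "E \<subseteq> M \<rightarrow>\<^sub>E M" using closure_of_subset_topspace[of \<Omega> G'] by (simp add: E top_\<Omega>)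
  have closed_E: "closedin \<Omega> E" by (simp add: E)
  have E_PiE: "p \<in> M \<rightarrow>\<^sub>E M" if "p \<in> E" for p using E_sub that by (rule subsetD)
  have E_app: "p x \<in> M" if "p \<in> E" "x \<in> M" for p x using E_PiE[OF that(1)] that(2) by (rule PiE_mem)
  have right_cont: "continuous_map \<Omega> \<Omega> (\<lambda>p. compose M p q)" if "q \<in> M \<rightarrow>\<^sub>E M" for q
    unfolding \<Omega>_def
  proof (rule continuous_map_coordinatewise_then_product)
    fix x assume "x \<in> M"
    then have "continuous_map (product_topology (\<lambda>_. Y) M) Y (\<lambda>p. p (q x))"
      using PiE_mem[OF that] by (intro continuous_map_product_coordinates) simp
    then show "continuous_map (product_topology (\<lambda>_. Y) M) Y (\<lambda>p. compose M p q x)"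
      using \<open>x \<in> M\<close> by (simp add: compose_def)
  qed (simp add: compose_def)
  have left_cont: "continuous_map \<Omega> \<Omega> (\<lambda>q. compose M h q)" if "h \<in> G" for h
    unfolding \<Omega>_def
  proof (rule continuous_map_coordinatewise_then_product)
    fix x assume x: "x \<in> M"
    then have "continuous_map (product_topology (\<lambda>_. Y) M) Y (\<lambda>q. q x)"
      by (rule continuous_map_product_coordinates)
    then have "continuous_map (product_topology (\<lambda>_. Y) M) Y (h \<circ> (\<lambda>q. q x))"
      using cont[OF that] by (rule continuous_map_compose)
    then show "continuous_map (product_topology (\<lambda>_. Y) M) Y (\<lambda>q. compose M h q x)"
      using x by (simp add: compose_def o_def)
  qed (simp add: compose_def)
  \<comment> \<open>The product \<open>p \<circ> q\<close> is always continuous in \<open>p\<close>, but its continuity in \<open>q\<close> rests on that of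
    the map \<open>p\<close>; hence left factors from \<open>G\<close> come first.\<close>
  have h_E: "compose M h q \<in> E" if h: "h \<in> G" and q: "q \<in> E" for h q
  proof -
    have "compose M h ` (\<Omega> closure_of G') \<subseteq> \<Omega> closure_of (compose M h ` G')"
      by (rule continuous_map_image_closure_subset[OF left_cont[OF h]])
    also have "compose M h ` G' \<subseteq> G'"
    proof
      fix k assume "k \<in> compose M h ` G'"
      then obtain h' where h': "h' \<in> G" "k = compose M h (restrict h' M)" unfolding G'_def by blast
      have "k = restrict (h \<circ> h') M"
        unfolding h'(2) by (rule ext) (simp add: compose_def restrict_def)
      then show "k \<in> G'" using comp[OF h h'(1)] unfolding G'_def by blast
    qed
    then have "\<Omega> closure_of (compose M h ` G') \<subseteq> \<Omega> closure_of G'" by (rule closure_of_mono)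
    finally have "compose M h ` E \<subseteq> E" by (simp only: E)
    then show ?thesis using q by blast
  qed
  have comp_E: "compose M p q \<in> E" if p: "p \<in> E" and q: "q \<in> E" for p q
  proof -
    have "(\<lambda>p. compose M p q) ` (\<Omega> closure_of G') \<subseteq> \<Omega> closure_of ((\<lambda>p. compose M p q) ` G')"
      by (intro continuous_map_image_closure_subset right_cont E_PiE q)
    also have "\<dots> \<subseteq> E"
    proof (rule closure_of_minimal[OF _ closed_E])
      show "(\<lambda>p. compose M p q) ` G' \<subseteq> E"
      proof
        fix k assume "k \<in> (\<lambda>p. compose M p q) ` G'"
        then obtain h where h: "h \<in> G" "k = compose M (restrict h M) q" unfolding G'_def by blast
        have "k = compose M h q"
          unfolding h(2) by (rule ext) (simp add: compose_def E_app[OF q])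
        then show "k \<in> E" using h_E[OF h(1) q] by simp
      qed
    qed
    finally have "(\<lambda>p. compose M p q) ` E \<subseteq> E" by (simp only: E)
    then show ?thesis using p by blast
  qed
  have assoc: "compose M (compose M p q) r = compose M p (compose M q r)" if "r \<in> E" for p q r :: "'a \<Rightarrow> 'a"
    by (rule ext) (simp add: compose_def E_app[OF that])
  have left_inverse: "\<exists>p\<in>E. \<forall>x\<in>M. p (g x) = x" if g: "g \<in> E" for g
  proof -
    define L where "L = (\<lambda>p. compose M p g) ` E"
    have L_E: "L \<subseteq> E" using comp_E[OF _ g] unfolding L_def by blast
    have mul_L: "compose M p q \<in> L" if p: "p \<in> L" and q: "q \<in> L" for p q
    proof -
      obtain q' where q': "q' \<in> E" "q = compose M q' g" using q by (auto simp: L_def)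
      then have eq: "compose M p q = compose M (compose M p q') g" using assoc[OF g] by simp
      have "compose M p q' \<in> E" by (rule comp_E[OF subsetD[OF L_E p] q'(1)])
      then show ?thesis unfolding eq L_def by (rule imageI)
    qed
    have L_sub: "L \<subseteq> topspace \<Omega>" using L_E E_sub top_\<Omega> by simp
    \<comment> \<open>The left ideal \<open>L = E g\<close> is a compact right topological semigroup.\<close>
    have "compactin \<Omega> L"
      unfolding L_def
      by (intro image_compactin[OF closedin_compact_space[OF \<Omega>(1) closed_E]] right_cont E_PiE g)
    then have L_compact: "compact_space (subtopology \<Omega> L)" by (rule compact_space_subtopology)
    have top: "topspace (subtopology \<Omega> L) = L" using L_sub by (simp add: Int_absorb1)
    obtain u where u: "u \<in> topspace (subtopology \<Omega> L)" "compose M u u = u"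
    proof (rule compact_right_topological_semigroup_idempotent[of "subtopology \<Omega> L" "compose M"])
      show "Hausdorff_space (subtopology \<Omega> L)" using \<Omega>(2) by (rule Hausdorff_space_subtopology)
      show "topspace (subtopology \<Omega> L) \<noteq> {}" unfolding top using g by (auto simp: L_def)
      fix q assume "q \<in> topspace (subtopology \<Omega> L)"
      then have q: "q \<in> L" by (simp only: top)
      show "continuous_map (subtopology \<Omega> L) (subtopology \<Omega> L) (\<lambda>p. compose M p q)"
      proof (rule continuous_map_into_subtopology)
        show "continuous_map (subtopology \<Omega> L) \<Omega> (\<lambda>p. compose M p q)"
          by (intro continuous_map_from_subtopology right_cont E_PiE subsetD[OF L_E q])
        show "(\<lambda>p. compose M p q) \<in> topspace (subtopology \<Omega> L) \<rightarrow> L"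
          unfolding top using mul_L q by blast
      qed
    next
      fix p q assume "p \<in> topspace (subtopology \<Omega> L)" "q \<in> topspace (subtopology \<Omega> L)"
      then show "compose M p q \<in> topspace (subtopology \<Omega> L)" unfolding top by (rule mul_L)
    next
      fix p q r :: "'a \<Rightarrow> 'a" assume "r \<in> topspace (subtopology \<Omega> L)"
      then have "r \<in> E" using L_E unfolding top by blast
      then show "compose M (compose M p q) r = compose M p (compose M q r)"
        by (rule assoc)
    qed (rule L_compact)
    have "u \<in> L" using u(1) by (simp only: top)
    note u = this u(2)
    have "u x = x" if x: "x \<in> M" for x
    proof -
      have "u (u x) = u x" using compose_eq[OF x, of u u] u(2) by simp
      moreover have "inj_on u M" using inj[of u] subsetD[OF L_E u(1)] by (simp add: E_def M_def)
      moreover have "u x \<in> M" using E_app[OF subsetD[OF L_E u(1)] x] .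
      ultimately show ?thesis using x by (meson inj_onD)
    qed
    moreover obtain p where p: "p \<in> E" "u = compose M p g" using u(1) unfolding L_def by blast
    ultimately have "p (g x) = x" if "x \<in> M" for x using compose_eq[OF that, of p g] that by simp
    with p(1) show ?thesis by blast
  qed
  obtain p where p: "p \<in> E" "\<And>x. x \<in> M \<Longrightarrow> p (g x) = x" using left_inverse[OF g[folded E_def]] by blast
  obtain q where q: "q \<in> E" "\<And>x. x \<in> M \<Longrightarrow> q (p x) = x" using left_inverse p(1) by blast
  have "q x = g x" if "x \<in> M" for x
    using p(2)[OF that] q(2)[OF E_app[OF g[folded E_def] that]] by simp
  then have "g (p x) = x" if "x \<in> M" for x using q(2)[OF that] E_app[OF p(1) that] by simp
  then show thesis using that[OF p(1)[unfolded E_def]] p(2) unfolding M_def by blast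
qed

section \<open>Weakly open sets of small norm diameter\<close>

lemma countable_dense_in_span:
  fixes D :: "'a::real_normed_vector set"
  assumes "countable D"
  obtains Q where "countable Q" "span D \<subseteq> closure Q"
proof -
  define g :: "(rat \<times> 'a) list \<Rightarrow> 'a" where "g l = (\<Sum>(q, d)\<leftarrow>l. of_rat q *\<^sub>R d)" for l
  define Q where "Q = g ` lists (UNIV \<times> D)"
  have "\<forall>e>0. \<exists>y\<in>Q. norm (y - x) < e" if "x \<in> span D" for x
    using that
  proof (induction rule: span_induct_alt)
    case base
    have "g [] \<in> Q" unfolding Q_def by (rule imageI) simp
    then show ?case by (auto simp: g_def intro!: bexI[of _ 0])
  next
    case (step c d y)
    show ?case
    proof (intro allI impI)
      fix e :: real assume "e > 0"
      then obtain w where w: "w \<in> Q" "norm (w - y) < e / 2" using step.IH by (meson half_gt_zero)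
      from w(1) obtain l where l: "l \<in> lists (UNIV \<times> D)" "w = g l" unfolding Q_def by blast
      define \<delta> where "\<delta> = (e / 2) / (norm d + 1)"
      have pos: "norm d + 1 > 0" using norm_ge_zero[of d] by linarith
      then have "\<delta> > 0" using \<open>e > 0\<close> by (simp add: \<delta>_def)
      then obtain q where q: "c < of_rat q" "of_rat q < c + \<delta>" using of_rat_dense[of c "c + \<delta>"] by auto
      have "(q, d) # l \<in> lists (UNIV \<times> D)" using l(1) step.hyps by simp
      then have "g ((q, d) # l) \<in> Q" unfolding Q_def by (rule imageI)
      moreover have "norm (g ((q, d) # l) - (c *\<^sub>R d + y)) < e"
      proof -
        have "g ((q, d) # l) - (c *\<^sub>R d + y) = (of_rat q - c) *\<^sub>R d + (w - y)"
          by (simp add: g_def l(2) algebra_simps)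
        then have "norm (g ((q, d) # l) - (c *\<^sub>R d + y)) \<le> norm ((of_rat q - c) *\<^sub>R d) + norm (w - y)"
          by (simp only: norm_triangle_ineq)
        also have "norm ((of_rat q - c) *\<^sub>R d) \<le> \<delta> * (norm d + 1)"
          unfolding norm_scaleR using q \<open>\<delta> > 0\<close> by (intro mult_mono) auto
        also have "\<delta> * (norm d + 1) = e / 2"
          using pos by (metis \<delta>_def less_irrefl nonzero_divide_eq_eq)
        finally show ?thesis using w(2) by simp
      qed
      ultimately show "\<exists>y'\<in>Q. norm (y' - (c *\<^sub>R d + y)) < e" ..
    qed
  qed
  then have "span D \<subseteq> closure Q" by (auto simp: closure_approachable dist_norm)
  moreover have "countable Q" unfolding Q_def using assms by (intro countable_image countable_lists) auto
  ultimately show thesis using that by simp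
qed

text \<open>
Countably many balls of radius \<open>\<epsilon> / 2\<close> cover \<open>M\<close>, and their traces are weakly closed in the
compact Hausdorff, hence Baire, space \<open>M\<close>.
\<close>

lemma weakly_compact_separable_small_open:
  fixes M :: "'a::real_normed_vector set"
  assumes M: "compactin weak_topology M" "M \<noteq> {}"
    and D: "countable D" "M \<subseteq> closure (span D)" and "\<epsilon> > 0"
  obtains U where "openin weak_topology U" "U \<inter> M \<noteq> {}"
    "\<And>x y. x \<in> U \<inter> M \<Longrightarrow> y \<in> U \<inter> M \<Longrightarrow> norm (x - y) \<le> \<epsilon>"
proof -
  obtain Q where Q: "countable Q" "span D \<subseteq> closure Q" using countable_dense_in_span[OF D(1)] .
  define Y where "Y = subtopology weak_topology M"
  define \<B> where "\<B> = (\<lambda>q. M \<inter> cball q (\<epsilon> / 2)) ` Q"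
  have top: "topspace Y = M" by (simp add: Y_def)
  have "compact_space Y" unfolding Y_def using M(1) by (rule compact_space_subtopology)
  moreover have "Hausdorff_space Y" unfolding Y_def by (rule Hausdorff_space_subtopology[OF Hausdorff_weak_topology])
  ultimately have Baire: "locally_compact_space Y \<and> regular_space Y"
    by (simp add: compact_imp_locally_compact_space compact_Hausdorff_imp_regular_space)
  have closed: "closedin Y B" if "B \<in> \<B>" for B
    using that closedin_weak_cball unfolding \<B>_def Y_def closedin_subtopology by (auto simp: Int_commute)
  have "M \<subseteq> \<Union>\<B>"
  proof
    fix x assume x: "x \<in> M"
    have "closure (span D) \<subseteq> closure Q" using Q(2) by (metis closure_closure closure_mono)
    with x D(2) have "x \<in> closure Q" by blast
    then obtain q where "q \<in> Q" "dist q x < \<epsilon> / 2" using \<open>\<epsilon> > 0\<close> unfolding closure_approachable by (meson half_gt_zero)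
    with x show "x \<in> \<Union>\<B>" by (auto simp: \<B>_def intro: less_imp_le)
  qed
  moreover have "\<Union>\<B> \<subseteq> M" by (auto simp: \<B>_def)
  ultimately have "\<Union>\<B> = topspace Y" using top by simp
  then have "Y interior_of \<Union>\<B> \<noteq> {}" using M(2) top by (metis interior_of_topspace)
  moreover have "countable \<B>" unfolding \<B>_def using Q(1) by simp
  ultimately obtain B where B: "B \<in> \<B>" "Y interior_of B \<noteq> {}"
    using Baire_category_alt[of Y \<B>] Baire closed by auto
  obtain U where U: "openin weak_topology U" "Y interior_of B = U \<inter> M"
    using openin_interior_of[of Y B] unfolding Y_def openin_subtopology by blast
  obtain q where q: "B = M \<inter> cball q (\<epsilon> / 2)" using B(1) by (auto simp: \<B>_def)
  show thesis
  proof (rule that[OF U(1)])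
    show "U \<inter> M \<noteq> {}" using B(2) U(2) by simp
    fix x y assume "x \<in> U \<inter> M" "y \<in> U \<inter> M"
    then have "x \<in> B" "y \<in> B" using interior_of_subset[of Y B] U(2) by auto
    then have "dist q x \<le> \<epsilon> / 2" "dist q y \<le> \<epsilon> / 2" by (simp_all add: q)
    then show "norm (x - y) \<le> \<epsilon>" using dist_triangle3[of x y q] by (simp add: dist_norm)
  qed
qed

section \<open>Minimal norm-distal flows\<close>

text \<open>
Minimality makes orbits weakly dense in \<open>M\<close>, and countability of \<open>G\<close> then makes \<open>M\<close> norm separable;
these are the two facts through which weak compactness and norm-distality interact.
\<close>

locale minimal_distal_flow =
  fixes G :: "('a::real_normed_vector \<Rightarrow> 'a) set" and M :: "'a set"
  assumes countable: "countable G" and nonempty: "G \<noteq> {}"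
    and cont: "g \<in> G \<Longrightarrow> continuous_map weak_topology weak_topology g"
    and comp: "g \<in> G \<Longrightarrow> h \<in> G \<Longrightarrow> g \<circ> h \<in> G"
    and nonexp: "g \<in> G \<Longrightarrow> norm (g x - g y) \<le> norm (x - y)"
    and distal: "x \<noteq> y \<Longrightarrow> \<exists>e>0. \<forall>g\<in>G. e \<le> norm (g x - g y)"
    and compact: "compactin weak_topology M" and M_nonempty: "M \<noteq> {}"
    and invariant: "g \<in> G \<Longrightarrow> g ` M \<subseteq> M"
    and minimal: "N \<subseteq> M \<Longrightarrow> closedin weak_topology N \<Longrightarrow> N \<noteq> {} \<Longrightarrow> (\<And>g. g \<in> G \<Longrightarrow> g ` N \<subseteq> N) \<Longrightarrow> N = M"
begin

lemma in_M: "g \<in> G \<Longrightarrow> x \<in> M \<Longrightarrow> g x \<in> M"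
  using invariant by blast

lemma orbit_dense:
  assumes "x \<in> M"
  shows "weak_topology closure_of ((\<lambda>g. g x) ` G) = M"
proof (rule minimal)
  let ?O = "(\<lambda>g. g x) ` G"
  have "closedin weak_topology M" using compactin_imp_closedin[OF Hausdorff_weak_topology compact] .
  then show "weak_topology closure_of ?O \<subseteq> M" by (intro closure_of_minimal) (use in_M assms in auto)
  show "closedin weak_topology (weak_topology closure_of ?O)" by simp
  have "?O \<subseteq> weak_topology closure_of ?O" by (rule closure_of_subset) simp
  then show "weak_topology closure_of ?O \<noteq> {}" using nonempty by auto
  fix h assume h: "h \<in> G"
  have "h ` (weak_topology closure_of ?O) \<subseteq> weak_topology closure_of (h ` ?O)"
    by (rule continuous_map_image_closure_subset[OF cont[OF h]])
  also have "h ` ?O \<subseteq> ?O"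
  proof -
    have "h (g x) \<in> ?O" if "g \<in> G" for g using comp[OF h that] by (metis comp_apply imageI)
    then show ?thesis by auto
  qed
  then have "weak_topology closure_of (h ` ?O) \<subseteq> weak_topology closure_of ?O" by (rule closure_of_mono)
  finally show "h ` (weak_topology closure_of ?O) \<subseteq> weak_topology closure_of ?O" .
qed

lemma orbit_meets_open:
  assumes "x \<in> M" "openin weak_topology U" "U \<inter> M \<noteq> {}"
  obtains g where "g \<in> G" "g x \<in> U"
proof -
  obtain y where "y \<in> U" "y \<in> M" using assms(3) by blast
  then have "y \<in> weak_topology closure_of ((\<lambda>g. g x) ` G)" using orbit_dense[OF assms(1)] by simp
  then show thesis using \<open>y \<in> U\<close> assms(2) that unfolding in_closure_of by blast
qed

text \<open>
Every orbit is countable and weakly dense, and closed subspaces are weakly closed; hence \<open>M\<close> lies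
in the closed span of a countable set.
\<close>

lemma small_open:
  assumes "\<epsilon> > 0"
  obtains U where "openin weak_topology U" "U \<inter> M \<noteq> {}"
    "\<And>x y. x \<in> U \<inter> M \<Longrightarrow> y \<in> U \<inter> M \<Longrightarrow> norm (x - y) \<le> \<epsilon>"
proof -
  obtain x where x: "x \<in> M" using M_nonempty by blast
  let ?O = "(\<lambda>g. g x) ` G"
  have "weak_topology closure_of ?O \<subseteq> closure (span ?O)"
    by (rule closure_of_minimal) (auto intro: closure_subset[THEN subsetD] span_base closedin_weak_closure_subspace)
  then have "M \<subseteq> closure (span ?O)" using orbit_dense[OF x] by simp
  moreover have "countable ?O" using countable by simp
  ultimately obtain U where "openin weak_topology U" "U \<inter> M \<noteq> {}"
    "\<And>x y. x \<in> U \<inter> M \<Longrightarrow> y \<in> U \<inter> M \<Longrightarrow> norm (x - y) \<le> \<epsilon>"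
    using weakly_compact_separable_small_open[OF compact M_nonempty _ _ assms] by metis
  then show thesis by (rule that)
qed

abbreviation "Y \<equiv> subtopology weak_topology M"

lemma topspace_Y: "topspace Y = M" by simp

lemma enveloping_subset: "enveloping_semigroup Y G \<subseteq> M \<rightarrow>\<^sub>E M"
  using closure_of_subset_topspace[of "product_topology (\<lambda>_. Y) M"]
  by (simp add: enveloping_semigroup_def)

lemma restrict_in_product: "g \<in> G \<Longrightarrow> restrict g M \<in> topspace (product_topology (\<lambda>_. Y) M)"
  using in_M by (simp add: restrict_PiE_iff)

lemma continuous_map_Y:
  assumes "g \<in> G" shows "continuous_map Y Y g"
proof (rule continuous_map_into_subtopology)
  show "continuous_map Y weak_topology g" using cont[OF assms] by (rule continuous_map_from_subtopology)
  show "g \<in> topspace Y \<rightarrow> M" using in_M[OF assms] by simp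
qed

lemma enveloping_contains: "g \<in> G \<Longrightarrow> restrict g M \<in> enveloping_semigroup Y G"
  unfolding enveloping_semigroup_def topspace_Y
  by (rule subsetD[OF closure_of_subset[OF image_subsetI[OF restrict_in_product]]]) auto

text \<open>
Norm distality implies weak distality. If \<open>p x = p y\<close>, minimality lets some \<open>t \<in> G\<close> move this point into
an open set of diameter below the distality constant of \<open>x\<close> and \<open>y\<close>. For \<open>g \<in> G\<close> close enough to \<open>p\<close>, both
\<open>t (g x)\<close> and \<open>t (g y)\<close> lie there, although \<open>t \<circ> g \<in> G\<close>.
\<close>

lemma enveloping_inj:
  assumes p: "p \<in> enveloping_semigroup Y G"
  shows "inj_on p M"
proof (rule inj_onI, rule ccontr)
  fix x y assume x: "x \<in> M" and y: "y \<in> M" and eq: "p x = p y" and "x \<noteq> y"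
  obtain e where e: "e > 0" "\<And>g. g \<in> G \<Longrightarrow> e \<le> norm (g x - g y)" using distal[OF \<open>x \<noteq> y\<close>] by blast
  obtain U where U: "openin weak_topology U" "U \<inter> M \<noteq> {}"
    "\<And>x y. x \<in> U \<inter> M \<Longrightarrow> y \<in> U \<inter> M \<Longrightarrow> norm (x - y) \<le> e / 2"
    using small_open[OF half_gt_zero[OF e(1)]] by metis
  have "p x \<in> M" using PiE_mem[OF subsetD[OF enveloping_subset p] x] .
  then obtain t where t: "t \<in> G" "t (p x) \<in> U" using orbit_meets_open U(1,2) by blast
  define \<Omega> where "\<Omega> = product_topology (\<lambda>_::'a. Y) M"
  have proj: "continuous_map \<Omega> weak_topology (t \<circ> (\<lambda>q. q z))" if "z \<in> M" for z
  proof -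
    have "continuous_map \<Omega> Y (\<lambda>q. q z)" unfolding \<Omega>_def using that by (rule continuous_map_product_coordinates)
    then have "continuous_map \<Omega> weak_topology (\<lambda>q. q z)" by (rule continuous_map_into_fulltopology)
    then show ?thesis using cont[OF t(1)] by (rule continuous_map_compose)
  qed
  define W where "W = {q \<in> topspace \<Omega>. (t \<circ> (\<lambda>q. q x)) q \<in> U} \<inter> {q \<in> topspace \<Omega>. (t \<circ> (\<lambda>q. q y)) q \<in> U}"
  have "openin \<Omega> W"
    unfolding W_def by (intro openin_Int openin_continuous_map_preimage[OF proj U(1)] x y)
  moreover have "p \<in> W"
  proof -
    have "p \<in> topspace \<Omega>" using subsetD[OF enveloping_subset p] by (simp add: \<Omega>_def)
    then show ?thesis using t(2) eq by (simp add: W_def)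
  qed
  moreover have "p \<in> \<Omega> closure_of ((\<lambda>g. restrict g M) ` G)"
    using p by (simp add: enveloping_semigroup_def \<Omega>_def)
  ultimately obtain g where g: "g \<in> G" "restrict g M \<in> W" unfolding in_closure_of by blast
  then have "t (g x) \<in> U" "t (g y) \<in> U" using x y by (simp_all add: W_def)
  moreover have "t (g x) \<in> M" "t (g y) \<in> M" using in_M t(1) g(1) x y by simp_all
  ultimately have "norm (t (g x) - t (g y)) \<le> e / 2" using U(3) by simp
  moreover have "e \<le> norm (t (g x) - t (g y))" using e(2)[OF comp[OF t(1) g(1)]] by simp
  ultimately show False using e(1) by simp
qed

text \<open>
Pointwise weak limits of nonexpansive maps are nonexpansive, as one sees by testing with
functionals of norm at most 1.
\<close>

lemma enveloping_nonexp:
  assumes p: "p \<in> enveloping_semigroup Y G" and x: "x \<in> M" and y: "y \<in> M"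
  shows "norm (p x - p y) \<le> norm (x - y)"
proof (rule iffD2[OF norm_le_iff_functionals], intro allI impI)
  fix f :: "'a \<Rightarrow>\<^sub>L real" assume f: "norm f \<le> 1"
  define \<Omega> where "\<Omega> = product_topology (\<lambda>_::'a. Y) M"
  have proj: "continuous_map \<Omega> euclideanreal (blinfun_apply f \<circ> (\<lambda>q. q z))" if "z \<in> M" for z
  proof -
    have "continuous_map \<Omega> Y (\<lambda>q. q z)" unfolding \<Omega>_def using that by (rule continuous_map_product_coordinates)
    then have "continuous_map \<Omega> weak_topology (\<lambda>q. q z)" by (rule continuous_map_into_fulltopology)
    then show ?thesis using continuous_map_weak_functional by (rule continuous_map_compose)
  qed
  have "continuous_map \<Omega> euclideanreal (\<lambda>q. (blinfun_apply f \<circ> (\<lambda>q. q x)) q - (blinfun_apply f \<circ> (\<lambda>q. q y)) q)"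
    by (intro continuous_map_diff proj x y)
  then have "closedin \<Omega> {q \<in> topspace \<Omega>. (blinfun_apply f \<circ> (\<lambda>q. q x)) q - (blinfun_apply f \<circ> (\<lambda>q. q y)) q \<in> {..norm (x - y)}}"
    by (rule closedin_continuous_map_preimage) simp
  moreover have "(\<lambda>g. restrict g M) ` G \<subseteq>
      {q \<in> topspace \<Omega>. (blinfun_apply f \<circ> (\<lambda>q. q x)) q - (blinfun_apply f \<circ> (\<lambda>q. q y)) q \<in> {..norm (x - y)}}"
  proof (rule image_subsetI)
    fix g assume g: "g \<in> G"
    have "blinfun_apply f (g x - g y) \<le> norm (x - y)"
      using iffD1[OF norm_le_iff_functionals nonexp[OF g, of x y]] f by simp
    then show "restrict g M \<in> {q \<in> topspace \<Omega>.
        (blinfun_apply f \<circ> (\<lambda>q. q x)) q - (blinfun_apply f \<circ> (\<lambda>q. q y)) q \<in> {..norm (x - y)}}"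
      using restrict_in_product[OF g, folded \<Omega>_def] x y by (simp add: blinfun.diff_right)
  qed
  ultimately have "\<Omega> closure_of ((\<lambda>g. restrict g M) ` G) \<subseteq>
      {q \<in> topspace \<Omega>. (blinfun_apply f \<circ> (\<lambda>q. q x)) q - (blinfun_apply f \<circ> (\<lambda>q. q y)) q \<in> {..norm (x - y)}}"
    by (intro closure_of_minimal)
  moreover have "p \<in> \<Omega> closure_of ((\<lambda>g. restrict g M) ` G)"
    using p by (simp add: enveloping_semigroup_def \<Omega>_def)
  ultimately show "blinfun_apply f (p x - p y) \<le> norm (x - y)" by (auto simp: blinfun.diff_right)
qed

text \<open>
The inverse of \<open>g\<close> in the enveloping semigroup is nonexpansive as well.
\<close>

lemma surjective_isometry:
  assumes g: "g \<in> G"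
  shows "g ` M = M" and "\<And>x y. x \<in> M \<Longrightarrow> y \<in> M \<Longrightarrow> norm (g x - g y) = norm (x - y)"
proof -
  obtain p where p: "p \<in> enveloping_semigroup Y G"
    and left: "\<And>x. x \<in> topspace Y \<Longrightarrow> p (restrict g M x) = x"
    and right: "\<And>x. x \<in> topspace Y \<Longrightarrow> restrict g M (p x) = x"
  proof (rule enveloping_semigroup_inverse[of Y G "restrict g M"])
    show "compact_space Y" using compact by (rule compact_space_subtopology)
    show "Hausdorff_space Y" by (rule Hausdorff_space_subtopology[OF Hausdorff_weak_topology])
    show "inj_on p (topspace Y)" if "p \<in> enveloping_semigroup Y G" for p
      unfolding topspace_Y using that by (rule enveloping_inj)
  qed (use g comp continuous_map_Y enveloping_contains in auto)
  have pM: "p x \<in> M" if "x \<in> M" for x using PiE_mem[OF subsetD[OF enveloping_subset p] that] .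
  have left: "p (g x) = x" if "x \<in> M" for x using left[of x] that by simp
  have right: "g (p x) = x" if "x \<in> M" for x using right[of x] pM[OF that] that by simp
  show "g ` M = M"
  proof
    show "M \<subseteq> g ` M" using right pM by (metis imageI subsetI)
  qed (rule invariant[OF g])
  show "norm (g x - g y) = norm (x - y)" if "x \<in> M" "y \<in> M" for x y
    using nonexp[OF g, of x y] enveloping_nonexp[OF p in_M[OF g that(1)] in_M[OF g that(2)]] left that by simp
qed

text \<open>
The sets \<open>{x. g x \<in> U}\<close>, for one small open \<open>U\<close>, cover \<open>M\<close> by minimality and are as small as \<open>U\<close> because
each \<open>g\<close> is an isometry on \<open>M\<close>.
\<close>

lemma totally_bounded:
  assumes "\<epsilon> > 0"
  obtains F where "finite F" "F \<subseteq> M" "\<And>y. y \<in> M \<Longrightarrow> \<exists>x\<in>F. norm (x - y) \<le> \<epsilon>"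
proof -
  obtain U where U: "openin weak_topology U" "U \<inter> M \<noteq> {}"
    "\<And>x y. x \<in> U \<inter> M \<Longrightarrow> y \<in> U \<inter> M \<Longrightarrow> norm (x - y) \<le> \<epsilon>"
    using small_open[OF assms] by metis
  define V where "V g = {x \<in> topspace weak_topology. g x \<in> U}" for g :: "'a \<Rightarrow> 'a"
  have "openin weak_topology (V g)" if "g \<in> G" for g
    unfolding V_def using cont[OF that] U(1) by (rule openin_continuous_map_preimage)
  moreover have "M \<subseteq> \<Union>(V ` G)"
  proof
    fix x assume "x \<in> M"
    then obtain g where "g \<in> G" "g x \<in> U" using orbit_meets_open U(1,2) by blast
    then show "x \<in> \<Union>(V ` G)" by (auto simp: V_def)
  qed
  ultimately obtain \<F> where \<F>: "finite \<F>" "\<F> \<subseteq> V ` G" "M \<subseteq> \<Union>\<F>"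
    using compactinD[OF compact, of "V ` G"] by auto
  define c where "c W = (SOME x. x \<in> W \<inter> M)" for W
  have c: "c W \<in> W \<inter> M" if "W \<inter> M \<noteq> {}" for W
    using that unfolding c_def some_in_eq .
  define F where "F = c ` {W \<in> \<F>. W \<inter> M \<noteq> {}}"
  show thesis
  proof (rule that)
    show "finite F" using \<F>(1) by (simp add: F_def)
    show "F \<subseteq> M" using c by (auto simp: F_def)
    fix y assume y: "y \<in> M"
    then obtain W where W: "W \<in> \<F>" "y \<in> W" using \<F>(3) by blast
    with y have "W \<inter> M \<noteq> {}" by blast
    then have cW: "c W \<in> W \<inter> M" "c W \<in> F" using c[of W] W(1) by (auto simp: F_def)
    obtain g where g: "g \<in> G" "W = V g" using W(1) \<F>(2) by blast
    have "norm (c W - y) = norm (g (c W) - g y)" using surjective_isometry(2)[OF g(1)] cW(1) y by simp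
    also have "\<dots> \<le> \<epsilon>" using U(3) in_M[OF g(1)] cW(1) W(2) y g(2) by (simp add: V_def)
    finally show "\<exists>x\<in>F. norm (x - y) \<le> \<epsilon>" using cW(2) by blast
  qed
qed

end

section \<open>Common fixed points\<close>

text \<open>
The barycenter of a finite \<open>d/2\<close>-net with \<open>n\<close> points: each \<open>y \<in> M\<close> has distance at most \<open>d/2\<close> from one of
the points and at most \<open>d\<close> from the others, hence at most \<open>d - d/(2n)\<close> from the barycenter.
\<close>

lemma nondiametral_point:
  fixes M :: "'a::real_normed_vector set"
  assumes F: "finite F" "F \<subseteq> M" "\<And>y. y \<in> M \<Longrightarrow> \<exists>x\<in>F. norm (x - y) \<le> d / 2"
    and d: "d > 0" "\<And>x y. x \<in> M \<Longrightarrow> y \<in> M \<Longrightarrow> norm (x - y) \<le> d" and "M \<noteq> {}"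
  obtains z r where "z \<in> convex hull M" "r < d" "\<And>y. y \<in> M \<Longrightarrow> norm (z - y) \<le> r"
proof -
  define n where "n = real (card F)"
  have "F \<noteq> {}" using F(3) \<open>M \<noteq> {}\<close> by blast
  then have n: "n > 0" using F(1) by (simp add: n_def card_gt_0_iff)
  define z where "z = (\<Sum>x\<in>F. (1 / n) *\<^sub>R x)"
  have one: "(\<Sum>x\<in>F. 1 / n) = 1" using n by (simp add: n_def)
  have "z \<in> convex hull M"
    unfolding z_def using n F(2) by (intro convex_sum[OF F(1) convex_convex_hull one]) (auto intro: hull_inc)
  moreover have "norm (z - y) \<le> d - d / (2 * n)" if y: "y \<in> M" for y
  proof -
    obtain x0 where x0: "x0 \<in> F" "norm (x0 - y) \<le> d / 2" using F(3)[OF y] by blast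
    have "y = (\<Sum>x\<in>F. (1 / n) *\<^sub>R y)"
      using scaleR_left.sum[of "\<lambda>_. 1 / n" F y] unfolding one by simp
    then have "z - y = (\<Sum>x\<in>F. (1 / n) *\<^sub>R (x - y))"
      by (simp add: z_def scaleR_diff_right sum_subtractf)
    then have "norm (z - y) \<le> (\<Sum>x\<in>F. (1 / n) * norm (x - y))"
      using n by (simp add: sum_norm_le)
    also have "\<dots> = (1 / n) * norm (x0 - y) + (\<Sum>x\<in>F - {x0}. (1 / n) * norm (x - y))"
      by (rule sum.remove[OF F(1) x0(1)])
    also have "\<dots> \<le> (1 / n) * (d / 2) + (\<Sum>x\<in>F - {x0}. (1 / n) * d)"
      using n x0(2) d(2) F(2) y by (intro add_mono sum_mono mult_left_mono) auto
    also have "(\<Sum>x\<in>F - {x0}. (1 / n) * d) = (\<Sum>x\<in>F. (1 / n) * d) - (1 / n) * d"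
      using sum.remove[OF F(1) x0(1), of "\<lambda>_. (1 / n) * d"] by simp
    also have "(\<Sum>x\<in>F. (1 / n) * d) = d" using n by (simp add: n_def)
    finally show ?thesis by (simp add: field_simps)
  qed
  moreover have "d - d / (2 * n) < d" using n d(1) by simp
  ultimately show thesis using that by blast
qed

text \<open>
Two nested minimal sets: \<open>K\<close> among the convex invariant sets and \<open>M\<close> among all invariant sets inside \<open>K\<close>.
The averaging argument takes place in \<open>K\<close>, while isometry and surjectivity are properties of \<open>M\<close>.
\<close>

lemma countable_semigroup_fixed_point:
  fixes G :: "('a::real_normed_vector \<Rightarrow> 'a) set"
  assumes G: "countable G" "G \<noteq> {}"
    and cont: "\<And>g. g \<in> G \<Longrightarrow> continuous_map weak_topology weak_topology g"
    and comp: "\<And>g h. g \<in> G \<Longrightarrow> h \<in> G \<Longrightarrow> g \<circ> h \<in> G"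
    and nonexp: "\<And>g x y. g \<in> G \<Longrightarrow> norm (g x - g y) \<le> norm (x - y)"
    and distal: "\<And>x y. x \<noteq> y \<Longrightarrow> \<exists>e>0. \<forall>g\<in>G. e \<le> norm (g x - g y)"
    and C: "compactin weak_topology C" "C \<noteq> {}" "convex C" "\<And>g. g \<in> G \<Longrightarrow> g ` C \<subseteq> C"
  obtains x where "x \<in> C" "\<And>g. g \<in> G \<Longrightarrow> g x = x"
proof -
  define P where "P K \<longleftrightarrow> convex K \<and> (\<forall>g\<in>G. g ` K \<subseteq> K)" for K :: "'a set"
  define I where "I M \<longleftrightarrow> (\<forall>g\<in>G. g ` M \<subseteq> M)" for M :: "'a set"
  have I_Inter: "I (\<Inter>\<C>)" if "\<And>C. C \<in> \<C> \<Longrightarrow> I C" for \<C>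
    using that unfolding I_def by blast
  have "P (\<Inter>\<C>)" if "\<And>C. C \<in> \<C> \<Longrightarrow> P C" for \<C>
    using that I_Inter[of \<C>] by (auto simp: P_def I_def intro: convex_Inter)
  moreover have "P C" using C by (simp add: P_def)
  moreover have closed_C: "closedin weak_topology C" using compactin_imp_closedin[OF Hausdorff_weak_topology C(1)] .
  ultimately obtain K where K: "K \<subseteq> C" "closedin weak_topology K" "K \<noteq> {}" "P K"
    and K_min: "\<And>N. N \<subseteq> K \<Longrightarrow> closedin weak_topology N \<Longrightarrow> N \<noteq> {} \<Longrightarrow> P N \<Longrightarrow> N = K"
    using compact_minimal_closed_subset[of weak_topology C P] C(1,2) by metis
  have compact_K: "compactin weak_topology K" using closed_compactin[OF C(1) K(1,2)] .
  have "I K" using K(4) by (simp add: P_def I_def)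
  then obtain M where M: "M \<subseteq> K" "closedin weak_topology M" "M \<noteq> {}" "I M"
    and M_min: "\<And>N. N \<subseteq> M \<Longrightarrow> closedin weak_topology N \<Longrightarrow> N \<noteq> {} \<Longrightarrow> I N \<Longrightarrow> N = M"
    using compact_minimal_closed_subset[of weak_topology K I] compact_K K(2,3) I_Inter by metis
  interpret minimal_distal_flow G M
  proof
    show "compactin weak_topology M" using closed_compactin[OF compact_K M(1,2)] .
    show "g ` M \<subseteq> M" if "g \<in> G" for g using M(4) that by (simp add: I_def)
    show "N = M" if "N \<subseteq> M" "closedin weak_topology N" "N \<noteq> {}" "\<And>g. g \<in> G \<Longrightarrow> g ` N \<subseteq> N" for N
      using M_min that by (simp add: I_def)
  qed (use G cont comp nonexp distal M(3) in auto)
  have "bounded M"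
  proof -
    obtain F where F: "finite F" "\<And>y. y \<in> M \<Longrightarrow> \<exists>x\<in>F. norm (x - y) \<le> 1" using totally_bounded[OF zero_less_one] by metis
    have "M \<subseteq> (\<Union>x\<in>F. cball x 1)" using F(2) by (auto simp: dist_norm)
    moreover have "bounded (\<Union>x\<in>F. cball x 1)" using F(1) by (intro bounded_UN) auto
    ultimately show ?thesis by (rule bounded_subset[rotated])
  qed
  then have diam: "norm (x - y) \<le> diameter M" if "x \<in> M" "y \<in> M" for x y
    using diameter_bounded_bound[of M x y] that by (simp add: dist_norm)
  have "diameter M = 0"
  proof (rule ccontr)
    assume "diameter M \<noteq> 0"
    then have d: "diameter M > 0" using diameter_ge_0[OF \<open>bounded M\<close>] by simp
    obtain F where F: "finite F" "F \<subseteq> M" "\<And>y. y \<in> M \<Longrightarrow> \<exists>x\<in>F. norm (x - y) \<le> diameter M / 2"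
      using totally_bounded[OF half_gt_zero[OF d]] by metis
    obtain z r where z: "z \<in> convex hull M" and r: "r < diameter M" "\<And>y. y \<in> M \<Longrightarrow> norm (z - y) \<le> r"
      using nondiametral_point[OF F d diam M(3)] by metis
    \<comment> \<open>The set of near-centers of \<open>M\<close> in \<open>K\<close>; minimality of \<open>K\<close> makes it all of \<open>K\<close>.\<close>
    define K' where "K' = K \<inter> (\<Inter>y\<in>M. cball y r)"
    have in_K': "x \<in> K' \<longleftrightarrow> x \<in> K \<and> (\<forall>y\<in>M. norm (x - y) \<le> r)" for x
      by (auto simp: K'_def dist_norm norm_minus_commute)
    have "K' = K"
    proof (rule K_min)
      show "K' \<subseteq> K" by (auto simp: K'_def)
      show "closedin weak_topology K'"
        unfolding K'_def using M(3) K(2) by (intro closedin_Int closedin_Inter) (auto intro: closedin_weak_cball)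
      have "convex hull M \<subseteq> K" using M(1) K(4) by (simp add: P_def hull_minimal)
      then have "z \<in> K'" using z r(2) in_K' by auto
      then show "K' \<noteq> {}" by blast
      have "g x \<in> K'" if g: "g \<in> G" and x: "x \<in> K'" for g x
      proof -
        have "norm (g x - y) \<le> r" if y: "y \<in> M" for y
        proof -
          obtain y' where y': "y' \<in> M" "y = g y'" using surjective_isometry(1)[OF g] y by blast
          have "norm (x - y') \<le> r" using x y'(1) in_K' by simp
          then show ?thesis using nonexp[OF g, of x y'] y'(2) by simp
        qed
        moreover have "g x \<in> K"
        proof -
          have "g ` K \<subseteq> K" using K(4) g unfolding P_def by blast
          then show ?thesis using x in_K' by blast
        qed
        ultimately show ?thesis using in_K' by simp
      qed
      moreover have "convex K'"
        unfolding K'_def using K(4) by (intro convex_Int convex_INT) (auto simp: P_def)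
      ultimately show "P K'" unfolding P_def by (simp add: image_subset_iff)
    qed
    then have "norm (x - y) \<le> r" if "x \<in> M" "y \<in> M" for x y
      using in_K'[of x] M(1) that by auto
    then have "diameter M \<le> r" using M(3) by (intro diameter_le) auto
    with r(1) show False by simp
  qed
  obtain x where x: "x \<in> M" using M(3) by blast
  have "g x = x" if "g \<in> G" for g
    using diam[OF in_M[OF that x] x] \<open>diameter M = 0\<close> by simp
  moreover have "x \<in> C" using x M(1) K(1) by blast
  ultimately show thesis using that by blast
qed

text \<open>
The products of nonempty finite words; a word is split as \<open>ws @ [s]\<close> since there need not be a unit.
\<close>

lemma countable_generated_subsemigroup:
  fixes F :: "'s::semigroup_mult set"
  assumes "countable F"
  obtains T where "countable T" "F \<subseteq> T" "\<And>s t. s \<in> T \<Longrightarrow> t \<in> T \<Longrightarrow> s * t \<in> T"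
proof
  define T where "T = (\<lambda>(ws, s). foldr (*) ws s) ` (lists F \<times> F)"
  have mult: "foldr (*) ws s * foldr (*) vs t = foldr (*) (ws @ s # vs) t" for ws vs :: "'s list" and s t
    by (induction ws) (simp_all add: mult.assoc)
  show "countable T" unfolding T_def using assms by (intro countable_image countable_SIGMA countable_lists) auto
  show "F \<subseteq> T"
  proof
    fix s assume "s \<in> F"
    then show "s \<in> T" unfolding T_def by (intro image_eqI[of _ _ "([], s)"]) auto
  qed
  show "s * t \<in> T" if "s \<in> T" "t \<in> T" for s t
  proof -
    obtain ws a where s: "s = foldr (*) ws a" "ws \<in> lists F" "a \<in> F" using \<open>s \<in> T\<close> by (auto simp: T_def)
    obtain vs b where t: "t = foldr (*) vs b" "vs \<in> lists F" "b \<in> F" using \<open>t \<in> T\<close> by (auto simp: T_def)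
    have "(ws @ a # vs, b) \<in> lists F \<times> F" using s t by simp
    then show ?thesis unfolding T_def s(1) t(1) mult by (rule rev_image_eqI) simp
  qed
qed

theorem theoremC:
  fixes act :: "'s::semigroup_mult \<Rightarrow> 'a::banach \<Rightarrow> 'a"
    and A :: "'a set"
  assumes "L_embedded TYPE('a)"
    and "weak_dynamical_system act"
    and "nonexpansive act"
    and "norm_distal act"
    and "A \<noteq> {}"
    and "bounded A"
    and "\<And>s. act s ` A = A"
  shows "\<exists>x \<in> chebyshev_center A. \<forall>s. act s x = x"
proof -
  let ?C = "chebyshev_center A"
  have mult: "act (s * t) x = act s (act t x)" and cont: "continuous_map weak_topology weak_topology (act s)" for s t x
    using assms(2) by (auto simp: weak_dynamical_system_def)
  have nonexp: "norm (act s x - act s y) \<le> norm (x - y)" for s x y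
    using assms(3) by (simp add: nonexpansive_def)
  have distal: "\<exists>e>0. \<forall>s. e \<le> norm (act s x - act s y)" if "x \<noteq> y" for x y
  proof -
    have "0 \<notin> closure (range (\<lambda>s. act s x - act s y))" using assms(4) that by (simp add: norm_distal_def)
    then show ?thesis unfolding closure_approachable by (auto simp: not_less)
  qed
  note C_balls = chebyshev_center_eq_INT_cball(1)[OF assms(5,6)]
  have C: "compactin weak_topology ?C" "?C \<noteq> {}"
    using chebyshev_center_weakly_compact[OF assms(1,5,6)] by simp_all
  have C_convex: "convex ?C" unfolding C_balls by (intro convex_INT) simp
  have C_invariant: "act s ` ?C \<subseteq> ?C" for s
  proof (rule image_subsetI)
    fix x assume x: "x \<in> ?C"
    let ?r = "INF z. SUP y\<in>A. norm (z - y)"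
    have "dist y (act s x) \<le> ?r" if y: "y \<in> A" for y
    proof -
      obtain a where a: "a \<in> A" "y = act s a" using assms(7)[of s] y by blast
      have "dist a x \<le> ?r" using x a(1) unfolding C_balls by simp
      then show ?thesis using nonexp[of s a x] a(2) by (simp add: dist_norm)
    qed
    then show "act s x \<in> ?C" unfolding C_balls by simp
  qed
  define Fix where "Fix s = {x. act s x = x}" for s
  have Fix_closed: "closedin weak_topology (Fix s)" for s
    using closedin_continuous_maps_eq[OF Hausdorff_weak_topology cont[of s] continuous_map_id]
    by (simp add: Fix_def)
  \<comment> \<open>By compactness finitely many maps, hence a countable subsemigroup, suffice.\<close>
  have "?C \<inter> \<Inter>(range Fix) \<noteq> {}"
  proof -
    have "?C \<inter> \<Inter>\<F> \<noteq> {}" if \<F>: "finite \<F>" "\<F> \<subseteq> range Fix" for \<F>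
    proof (cases "\<F> = {}")
      case False
      obtain F where F: "finite F" "\<F> = Fix ` F" using finite_subset_image[OF \<F>] by blast
      obtain T where T: "countable T" "F \<subseteq> T" "\<And>s t. s \<in> T \<Longrightarrow> t \<in> T \<Longrightarrow> s * t \<in> T"
        using countable_generated_subsemigroup[OF countable_finite[OF F(1)]] by metis
      obtain x where x: "x \<in> ?C" "\<And>g. g \<in> act ` T \<Longrightarrow> g x = x"
      proof (rule countable_semigroup_fixed_point[of "act ` T" ?C])
        show "countable (act ` T)" using T(1) by simp
        show "act ` T \<noteq> {}" using False F(2) T(2) by auto
        show "g \<circ> h \<in> act ` T" if "g \<in> act ` T" "h \<in> act ` T" for g h
        proof -
          obtain s t where st: "s \<in> T" "g = act s" "t \<in> T" "h = act t" using \<open>g \<in> act ` T\<close> \<open>h \<in> act ` T\<close> by blast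
          then have "g \<circ> h = act (s * t)" by (simp add: fun_eq_iff mult)
          then show ?thesis using T(3) st by blast
        qed
        show "\<exists>e>0. \<forall>g\<in>act ` T. e \<le> norm (g x - g y)" if "x \<noteq> y" for x y
          using distal[OF that] by blast
        show "g ` ?C \<subseteq> ?C" if "g \<in> act ` T" for g
        proof -
          obtain s where "g = act s" using \<open>g \<in> act ` T\<close> by blast
          then show ?thesis using C_invariant by simp
        qed
      qed (use C C_convex cont nonexp in auto)
      then have "x \<in> \<Inter>\<F>" using T(2) unfolding F(2) Fix_def by blast
      with x(1) show ?thesis by blast
    qed (use C in simp)
    then show ?thesis
      using C(1)[unfolded compactin_fip, THEN conjunct2, rule_format, of "range Fix"] Fix_closed by auto
  qed
  then obtain x where "x \<in> ?C" "x \<in> \<Inter>(range Fix)" by blast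
  then show ?thesis by (auto simp: Fix_def)
qed

end
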